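(* Let $d\ge3$ and let $k$ be a field with $\mathrm{char}\,k=0$ or $\mathrm{char}\,k>d$. Let $\varphi$ be a nondegenerate decomposable form of dimension $n$ and degree $d$ over $k$, let $X=(x_1,\dots,x_n)$ be independent indeterminates, $K=k(X)$, and let $$\varphi_K=\varphi_1\perp\dots\perp\varphi_r$$ for some $r>1$, with indecomposable components $\varphi_i$ (over $K$). (i) If $\dim\varphi_i\neq\dim\varphi_j$ for all $i\neq j$ and there exists an $i_0$ such that $\varphi(X)\notin G(\varphi_{i_0})$, then $\varphi$ is not strongly multiplicative. (ii) Suppose there exist $i_0\neq i_1$ such that $\dim\varphi_{i_0}=\dim\varphi_{i_1}$ and $\dim\varphi_i\neq\dim\varphi_{i_0}$ for all $i\notin\{i_0,i_1\}$. If there are $h,s\in\{i_0,i_1\}$ such that $\varphi(X)\notin G(\varphi_h)$ and $\varphi(X)^2\notin G(\varphi_s)$, then $\varphi$ is not strongly multiplicative. (iii) Suppose there exist $i_0\neq i_1$ with $\dim\varphi_{i_0}\neq\dim\varphi_{i_1}$, such that $\dim\varphi_i=\dim\varphi_j$ for all $i,j\notin\{i_0,i_1\}$ and $\dim\varphi_i\neq\dim\varphi_{i_0}$, $\dim\varphi_i\neq\dim\varphi_{i_1}$ for all $i\notin\{i_0,i_1\}$. If there is $h\in\{i_0,i_1\}$ with $\varphi(X)\notin G(\varphi_h)$, then $\varphi$ is not strongly multiplicative.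
   Context: A form of degree $d$ on a finite-dimensional vector space $V$ over a field $F$ is a map $\varphi:V\to F$ which in coordinates is given by a homogeneous polynomial of degree $d$; it corresponds to a unique symmetric $d$-linear form $\theta$ with $\varphi(v)=\theta(v,\dots,v)$, and it is nondegenerate if $v=0$ is the only vector with $\theta(v,v_2,\dots,v_d)=0$ for all $v_i\in V$. Its dimension is $\dim V$. Two forms are isomorphic ($\cong$) if they correspond to each other under a bijective linear map of the underlying spaces. The orthogonal sum $\varphi_1\perp\varphi_2$ is the form $u_1+u_2\mapsto\varphi_1(u_1)+\varphi_2(u_2)$ on $V_1\oplus V_2$. A nonzero form is decomposable if it is isomorphic to an orthogonal sum of two forms on nonzero spaces, and indecomposable otherwise. $\varphi_K$ is the extension of scalars of $\varphi$ to $K$, and $\varphi(X)\in K$ is the generic value of $\varphi$, i.e. the homogeneous polynomial representing $\varphi$ in some basis. For a form $\psi$ over $K$, $G(\psi)=\{a\in K^\times\mid a\psi\cong\psi\}$. $\varphi$ is strongly multiplicative if $\varphi(X)\varphi_K\cong\varphi_K$ over $K$. *)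

theory Defs
  imports
    "HOL-Analysis.Analysis"
    "HOL-Library.Poly_Mapping"
    "HOL-Library.Multiset"
    "HOL-Computational_Algebra.Fraction_Field"
begin

subsection \<open>Polynomials and rational functions in several variables\<close>

text \<open>Coefficients are indexed by monomials, and monomials map variables to exponents.\<close>

type_synonym ('x, 'a) mpoly = "('x \<Rightarrow>\<^sub>0 nat) \<Rightarrow>\<^sub>0 'a"

text \<open>
  For a finite type \<^typ>\<open>'n\<close> this is the field \<open>k(X)\<close> with one indeterminate for every element
  of \<^typ>\<open>'n\<close>. A linear order on \<^typ>\<open>'n\<close> is needed only to have the library's instance saying
  that the polynomial ring is an integral domain.
\<close>

type_synonym ('n, 'k) ratfun = "('n, 'k) mpoly fract"

definition homogeneous :: "nat \<Rightarrow> ('x, 'a::zero) mpoly \<Rightarrow> bool" where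
  "homogeneous d P \<longleftrightarrow> (\<forall>m \<in> Poly_Mapping.keys P. (\<Sum>x\<in>Poly_Mapping.keys m. Poly_Mapping.lookup m x) = d)"

definition vars :: "('x, 'a::zero) mpoly \<Rightarrow> 'x set" where
  "vars P = (\<Union>m \<in> Poly_Mapping.keys P. Poly_Mapping.keys m)"

text \<open>Evaluation at \<open>c\<close> after applying \<open>h\<close> to the coefficients.\<close>

definition eval_map :: "('a::zero \<Rightarrow> 'b::comm_semiring_1) \<Rightarrow> ('x, 'a) mpoly \<Rightarrow> ('x \<Rightarrow> 'b) \<Rightarrow> 'b" where
  "eval_map h P c = (\<Sum>m \<in> Poly_Mapping.keys P.
     h (Poly_Mapping.lookup P m) * (\<Prod>x \<in> Poly_Mapping.keys m. c x ^ Poly_Mapping.lookup m x))"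

definition to_ratfun :: "('n::{finite, linorder}, 'k::field) mpoly \<Rightarrow> ('n, 'k) ratfun" where
  "to_ratfun P = Fract P 1"

definition const_ratfun :: "'k::field \<Rightarrow> ('n::{finite, linorder}, 'k) ratfun" where
  "const_ratfun a = to_ratfun (Poly_Mapping.single 0 a)"


subsection \<open>Forms\<close>

text \<open>
  The underlying space is a subspace \<open>fspace\<close> of an ambient vector space with scalar
  multiplication \<open>scal\<close>; the values of \<open>val\<close> outside \<open>fspace\<close> are irrelevant.
\<close>

record ('a, 'v) form =
  scal :: "'a \<Rightarrow> 'v \<Rightarrow> 'v"
  fspace :: "'v set"
  val :: "'v \<Rightarrow> 'a"

definition is_basis :: "('a::field, 'v::ab_group_add) form \<Rightarrow> 'i set \<Rightarrow> ('i \<Rightarrow> 'v) \<Rightarrow> bool" where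
  "is_basis \<Phi> I b \<longleftrightarrow> finite I \<and> inj_on b I \<and> \<not> module.dependent (scal \<Phi>) (b ` I) \<and>
     module.span (scal \<Phi>) (b ` I) = fspace \<Phi>"

definition represents ::
  "nat \<Rightarrow> ('a::field, 'v::ab_group_add) form \<Rightarrow> 'i set \<Rightarrow> ('i \<Rightarrow> 'v) \<Rightarrow> ('i, 'a) mpoly \<Rightarrow> bool" where
  "represents d \<Phi> I b P \<longleftrightarrow> homogeneous d P \<and> vars P \<subseteq> I \<and>
     (\<forall>c. val \<Phi> (\<Sum>i\<in>I. scal \<Phi> (c i) (b i)) = eval_map id P c)"

definition is_form :: "nat \<Rightarrow> ('a::field, 'v::ab_group_add) form \<Rightarrow> bool" where
  "is_form d \<Phi> \<longleftrightarrow> vector_space (scal \<Phi>) \<and>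
     (\<exists>(n::nat) b P. is_basis \<Phi> {..<n} b \<and> represents d \<Phi> {..<n} b P)"

definition form_dim :: "('a::field, 'v::ab_group_add) form \<Rightarrow> nat" where
  "form_dim \<Phi> = vector_space.dim (scal \<Phi>) (fspace \<Phi>)"

text \<open>Argument tuples of \<open>d\<close>-linear forms are lists of length \<open>d\<close>.\<close>

definition symmetric_multilinear ::
  "nat \<Rightarrow> ('a::field, 'v::ab_group_add) form \<Rightarrow> ('v list \<Rightarrow> 'a) \<Rightarrow> bool" where
  "symmetric_multilinear d \<Phi> \<theta> \<longleftrightarrow>
     (\<forall>vs ws. length vs = d \<and> set vs \<subseteq> fspace \<Phi> \<and> mset ws = mset vs \<longrightarrow> \<theta> ws = \<theta> vs) \<and>
     (\<forall>vs i u v a. length vs = d \<and> set vs \<subseteq> fspace \<Phi> \<and> i < d \<and> u \<in> fspace \<Phi> \<and> v \<in> fspace \<Phi> \<longrightarrow>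
        \<theta> (vs[i := u + v]) = \<theta> (vs[i := u]) + \<theta> (vs[i := v]) \<and>
        \<theta> (vs[i := scal \<Phi> a u]) = a * \<theta> (vs[i := u]))"

text \<open>
  The form \<open>\<theta>\<close> below is unique on \<open>fspace \<Phi>\<close> if \<open>d!\<close> is invertible, that is, in characteristic
  \<open>0\<close> or \<open>> d\<close>.
\<close>

definition nondegenerate :: "nat \<Rightarrow> ('a::field, 'v::ab_group_add) form \<Rightarrow> bool" where
  "nondegenerate d \<Phi> \<longleftrightarrow>
     (\<exists>\<theta>. symmetric_multilinear d \<Phi> \<theta> \<and> (\<forall>v \<in> fspace \<Phi>. val \<Phi> v = \<theta> (replicate d v)) \<and>
       (\<forall>v \<in> fspace \<Phi>.
          (\<forall>vs. length vs = d - 1 \<and> set vs \<subseteq> fspace \<Phi> \<longrightarrow> \<theta> (v # vs) = 0) \<longrightarrow> v = 0))"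

definition form_iso ::
  "('a::field, 'v::ab_group_add) form \<Rightarrow> ('a, 'w::ab_group_add) form \<Rightarrow> bool" (infix \<open>\<cong>\<^sub>F\<close> 50) where
  "\<Phi> \<cong>\<^sub>F \<Psi> \<longleftrightarrow> (\<exists>f. bij_betw f (fspace \<Phi>) (fspace \<Psi>) \<and>
     (\<forall>u\<in>fspace \<Phi>. \<forall>v\<in>fspace \<Phi>. f (u + v) = f u + f v) \<and>
     (\<forall>a. \<forall>v\<in>fspace \<Phi>. f (scal \<Phi> a v) = scal \<Psi> a (f v)) \<and>
     (\<forall>v\<in>fspace \<Phi>. val \<Psi> (f v) = val \<Phi> v))"


subsection \<open>Orthogonal sums and decomposability\<close>

definition orth_sum ::
  "('a::field, 'v::ab_group_add) form \<Rightarrow> ('a, 'w::ab_group_add) form \<Rightarrow> ('a, 'v \<times> 'w) form" where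
  "orth_sum \<Phi> \<Psi> = \<lparr>
     scal = (\<lambda>a u. (scal \<Phi> a (fst u), scal \<Psi> a (snd u))),
     fspace = fspace \<Phi> \<times> fspace \<Psi>,
     val = (\<lambda>u. val \<Phi> (fst u) + val \<Psi> (snd u))\<rparr>"

definition orth_sum_family ::
  "('r::finite \<Rightarrow> ('a::field, 'w::ab_group_add) form) \<Rightarrow> ('a, 'w ^ 'r) form" where
  "orth_sum_family F = \<lparr>
     scal = (\<lambda>a u. \<chi> i. scal (F i) a (u $ i)),
     fspace = {u. \<forall>i. u $ i \<in> fspace (F i)},
     val = (\<lambda>u. \<Sum>i\<in>UNIV. val (F i) (u $ i))\<rparr>"

definition nonzero_form :: "('a::field, 'v::ab_group_add) form \<Rightarrow> bool" where
  "nonzero_form \<Phi> \<longleftrightarrow> (\<exists>v \<in> fspace \<Phi>. val \<Phi> v \<noteq> 0)"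

text \<open>
  Taking the two summands in the same ambient type as \<open>\<Phi>\<close> is no restriction: their spaces are
  isomorphic to subspaces of \<open>fspace \<Phi>\<close>.
\<close>

definition decomposable :: "nat \<Rightarrow> ('a::field, 'v::ab_group_add) form \<Rightarrow> bool" where
  "decomposable d \<Phi> \<longleftrightarrow> nonzero_form \<Phi> \<and>
     (\<exists>(\<Phi>\<^sub>1 :: ('a, 'v) form) (\<Phi>\<^sub>2 :: ('a, 'v) form). is_form d \<Phi>\<^sub>1 \<and> is_form d \<Phi>\<^sub>2 \<and>
        fspace \<Phi>\<^sub>1 \<noteq> {0} \<and> fspace \<Phi>\<^sub>2 \<noteq> {0} \<and> \<Phi> \<cong>\<^sub>F orth_sum \<Phi>\<^sub>1 \<Phi>\<^sub>2)"

definition indecomposable :: "nat \<Rightarrow> ('a::field, 'v::ab_group_add) form \<Rightarrow> bool" where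
  "indecomposable d \<Phi> \<longleftrightarrow> nonzero_form \<Phi> \<and> \<not> decomposable d \<Phi>"


subsection \<open>Similarity factors and strongly multiplicative forms\<close>

definition scale_form :: "'a::field \<Rightarrow> ('a, 'v::ab_group_add) form \<Rightarrow> ('a, 'v) form" where
  "scale_form a \<Psi> = \<Psi>\<lparr>val := (\<lambda>v. a * val \<Psi> v)\<rparr>"

definition similarity_factors :: "('a::field, 'v::ab_group_add) form \<Rightarrow> 'a set" where
  "similarity_factors \<Psi> = {a. a \<noteq> 0 \<and> scale_form a \<Psi> \<cong>\<^sub>F \<Psi>}"

text \<open>
  The homogeneous polynomial representing a form of degree \<open>d\<close> in the basis \<open>b\<close>; it is unique if
  the characteristic is \<open>0\<close> or \<open>> d\<close>, since then the field has more than \<open>d\<close> elements.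
\<close>

definition coord_poly ::
  "nat \<Rightarrow> ('n::finite \<Rightarrow> 'v) \<Rightarrow> ('k::field, 'v::ab_group_add) form \<Rightarrow> ('n, 'k) mpoly" where
  "coord_poly d b \<Phi> = (THE P. represents d \<Phi> UNIV b P)"

definition generic_value ::
  "nat \<Rightarrow> ('n::{finite, linorder} \<Rightarrow> 'v) \<Rightarrow> ('k::field, 'v::ab_group_add) form \<Rightarrow> ('n, 'k) ratfun" where
  "generic_value d b \<Phi> = to_ratfun (coord_poly d b \<Phi>)"

text \<open>
  The basis \<open>b\<close> of \<open>V\<close> identifies \<open>V \<otimes> K\<close> with \<open>K\<^sup>n\<close>, where the extended form is given by the
  same polynomial as the original one.
\<close>

definition scalar_extension ::
  "nat \<Rightarrow> ('n::{finite, linorder} \<Rightarrow> 'v) \<Rightarrow> ('k::field, 'v::ab_group_add) form \<Rightarrow>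
     (('n, 'k) ratfun, (('n, 'k) ratfun, 'n) vec) form" where
  "scalar_extension d b \<Phi> = \<lparr>
     scal = (*s),
     fspace = UNIV,
     val = (\<lambda>v. eval_map const_ratfun (coord_poly d b \<Phi>) (\<lambda>i. v $ i))\<rparr>"

definition strongly_multiplicative ::
  "nat \<Rightarrow> ('n::{finite, linorder} \<Rightarrow> 'v) \<Rightarrow> ('k::field, 'v::ab_group_add) form \<Rightarrow> bool" where
  "strongly_multiplicative d b \<Phi> \<longleftrightarrow>
     scale_form (generic_value d b \<Phi>) (scalar_extension d b \<Phi>) \<cong>\<^sub>F scalar_extension d b \<Phi>"

end

theory Submission
  imports Defs
begin

text \<open>
  Suppose that \<open>\<phi>\<close> is strongly multiplicative and put \<open>a = \<phi>(X)\<close>. Transported to the orthogonal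
  sum \<open>V\<close> of the components \<open>F i\<close>, the isomorphism \<open>a \<phi>\<^sub>K \<cong> \<phi>\<^sub>K\<close> becomes a bijective linear map
  \<open>h\<close> of \<open>V\<close> with \<open>q (h v) = a q v\<close>, where \<open>q\<close> is the form on \<open>V\<close>. For
  \<open>d \<ge> 3\<close> the decomposition into indecomposable components is not only unique up to isomorphism: the subspaces themselves are determined by the form.
  Hence \<open>h\<close> permutes the summands, and \<open>a F i \<cong> F (\<sigma> i)\<close> for a permutation \<open>\<sigma>\<close> that preserves
  dimensions (\<open>similitude_permutes_summands\<close>). The hypotheses on the dimensions leave little choice
  for \<open>\<sigma>\<close>: either it fixes an index \<open>i\<close>, so that \<open>a \<in> G(F i)\<close>, or it interchanges two indices \<open>i\<close>
  and \<open>j\<close>, so that \<open>a\<^sup>2 F i \<cong> a F j \<cong> F i\<close>. Each contradicts the assumption made in its case.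

  Uniqueness of the summands amounts to the fact that any two orthogonal projections \<open>e\<close> and \<open>f\<close>
  of \<open>V\<close> commute. In terms of the symmetric \<open>d\<close>-linear form one has
  \<open>\<theta>(e x, y, z, \<dots>) = \<theta>(x, e y, z, \<dots>)\<close>, and three arguments are enough to move \<open>e\<close> and \<open>f\<close> past
  each other. The proof below works with \<open>q\<close> alone and replaces \<open>\<theta>\<close> by finite differences: second
  differences of \<open>q\<close> admit the same exchange (\<open>second_difference_projection\<close>), and third
  differences provide the third argument. The outcome is that, for \<open>r = e f x - f e x\<close> and all
  scalars \<open>s\<close>, the function \<open>w \<mapsto> q (s r + w) - q w\<close> is additive up to a constant
  (\<open>commutator_affine\<close>).

  Since \<open>1, \<dots>, d\<close> are invertible, a comparison of coefficients turns this into the vanishing of the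
  derivative of \<open>q\<close> in direction \<open>r\<close>, and then into \<open>q (s r + w) = q w\<close>
  (\<open>val_translation_invariant\<close>). An indecomposable form has no such direction \<open>r \<noteq> 0\<close>, since a zero
  form on the line through \<open>r\<close> would split off (\<open>indecomposable_radical_trivial\<close>); applied in every
  component of \<open>V\<close>, this gives \<open>r = 0\<close>.

  Finally let \<open>W\<^sub>i\<close> be the summands of \<open>V\<close> and \<open>e\<^sub>j\<close> the projections onto them. As \<open>h\<^sup>-\<^sup>1 e\<^sub>j h\<close> commutes
  with \<open>e\<^sub>i\<close>, it restricts to an orthogonal projection of the indecomposable space \<open>W\<^sub>i\<close>, hence to
  \<open>0\<close> or to the identity. So \<open>h\<close> maps \<open>W\<^sub>i\<close> into a single \<open>W\<^sub>j\<close>; the same for \<open>h\<^sup>-\<^sup>1\<close> shows that it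
  maps onto.
\<close>

section \<open>Homogeneous polynomial functions\<close>

definition homogeneous_function :: "nat \<Rightarrow> 'i set \<Rightarrow> (('i \<Rightarrow> 'a::field) \<Rightarrow> 'a) \<Rightarrow> bool" where
  "homogeneous_function d I f \<longleftrightarrow>
     (\<exists>P. homogeneous d P \<and> vars P \<subseteq> I \<and> (\<forall>c. f c = eval_map id P c))"

lemma eval_map_superset:
  fixes P :: "('x, 'a::field) mpoly"
  assumes "finite A" "Poly_Mapping.keys P \<subseteq> A"
  shows "eval_map id P c = (\<Sum>m\<in>A. Poly_Mapping.lookup P m *
           (\<Prod>x \<in> Poly_Mapping.keys m. c x ^ Poly_Mapping.lookup m x))"
  unfolding eval_map_def id_def
  by (rule sum.mono_neutral_left) (use assms in \<open>auto simp: in_keys_iff\<close>)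

lemma homogeneous_function_zero: "homogeneous_function d I (\<lambda>c. 0)"
  unfolding homogeneous_function_def
  by (rule exI[of _ 0]) (auto simp: homogeneous_def vars_def eval_map_def)

lemma homogeneous_function_monomial:
  assumes "Poly_Mapping.keys m \<subseteq> I" "(\<Sum>x\<in>Poly_Mapping.keys m. Poly_Mapping.lookup m x) = d"
  shows "homogeneous_function d I
           (\<lambda>c. a * (\<Prod>x \<in> Poly_Mapping.keys m. c x ^ Poly_Mapping.lookup m x))"
  unfolding homogeneous_function_def
  by (rule exI[of _ "Poly_Mapping.single m a"])
    (use assms in \<open>auto simp: homogeneous_def vars_def eval_map_def split: if_splits\<close>)

lemma homogeneous_function_add:
  assumes "homogeneous_function d I f" "homogeneous_function d I g"
  shows "homogeneous_function d I (\<lambda>c. f c + g c)"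
proof -
  obtain P Q where P: "homogeneous d P" "vars P \<subseteq> I" "\<And>c. f c = eval_map id P c"
    and Q: "homogeneous d Q" "vars Q \<subseteq> I" "\<And>c. g c = eval_map id Q c"
    using assms by (auto simp: homogeneous_function_def)
  let ?A = "Poly_Mapping.keys P \<union> Poly_Mapping.keys Q"
  have sub: "Poly_Mapping.keys (P + Q) \<subseteq> ?A" by (rule Poly_Mapping.keys_add)
  have "f c + g c = eval_map id (P + Q) c" for c
    using sub by (simp add: P(3) Q(3) eval_map_superset[of ?A] lookup_add sum.distrib ring_distribs)
  moreover have "homogeneous d (P + Q)" "vars (P + Q) \<subseteq> I"
    using P Q sub unfolding homogeneous_def vars_def by blast+
  ultimately show ?thesis unfolding homogeneous_function_def by blast
qed

lemma homogeneous_function_sum: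
  assumes "\<And>x. x \<in> A \<Longrightarrow> homogeneous_function d I (f x)"
  shows "homogeneous_function d I (\<lambda>c. \<Sum>x\<in>A. f x c)"
  using assms
  by (induction A rule: infinite_finite_induct)
    (auto intro: homogeneous_function_zero homogeneous_function_add)

lemma homogeneous_function_cmult:
  assumes "homogeneous_function d I f"
  shows "homogeneous_function d I (\<lambda>c. a * f c)"
proof -
  obtain P where P: "homogeneous d P" "vars P \<subseteq> I" "\<And>c. f c = eval_map id P c"
    using assms by (auto simp: homogeneous_function_def)
  have "homogeneous_function d I (\<lambda>c. \<Sum>m\<in>Poly_Mapping.keys P. (a * Poly_Mapping.lookup P m) *
           (\<Prod>x \<in> Poly_Mapping.keys m. c x ^ Poly_Mapping.lookup m x))"
    by (rule homogeneous_function_sum, rule homogeneous_function_monomial)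
      (use P in \<open>auto simp: homogeneous_def vars_def\<close>)
  then show ?thesis
    by (simp add: P(3) eval_map_def sum_distrib_left mult.assoc)
qed

lemma homogeneous_function_variable_mult:
  fixes f :: "('b \<Rightarrow> 'a::field) \<Rightarrow> 'a"
  assumes "homogeneous_function d I f" "i \<in> I"
  shows "homogeneous_function (Suc d) I (\<lambda>c. c i * f c)"
proof -
  obtain P where P: "homogeneous d P" "vars P \<subseteq> I" "\<And>c. f c = eval_map id P c"
    using assms by (auto simp: homogeneous_function_def)
  define e where "e = Poly_Mapping.single i (Suc 0)"
  have e: "Poly_Mapping.lookup e x = (if x = i then 1 else 0)" for x
    by (simp add: e_def lookup_single when_def)
  have keys: "Poly_Mapping.keys (m + e) = insert i (Poly_Mapping.keys m)" for m
    by (auto simp: in_keys_iff lookup_add e split: if_splits)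
  have deg: "(\<Sum>x\<in>Poly_Mapping.keys (m + e). Poly_Mapping.lookup (m + e) x) =
      Suc (\<Sum>x\<in>Poly_Mapping.keys m. Poly_Mapping.lookup m x)" for m
  proof -
    let ?A = "insert i (Poly_Mapping.keys m)"
    have "(\<Sum>x\<in>Poly_Mapping.keys m. Poly_Mapping.lookup m x) = (\<Sum>x\<in>?A. Poly_Mapping.lookup m x)"
      by (rule sum.mono_neutral_left) (auto simp: in_keys_iff)
    moreover have "(\<Sum>x\<in>?A. Poly_Mapping.lookup e x) = 1"
      unfolding e by (subst sum.delta) auto
    ultimately show ?thesis
      unfolding keys lookup_add sum.distrib by presburger
  qed
  have val: "(\<Prod>x\<in>Poly_Mapping.keys (m + e). c x ^ Poly_Mapping.lookup (m + e) x) =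
      c i * (\<Prod>x\<in>Poly_Mapping.keys m. c x ^ Poly_Mapping.lookup m x)" for m and c :: "'b \<Rightarrow> 'a"
  proof -
    let ?A = "insert i (Poly_Mapping.keys m)"
    have 1: "(\<Prod>x\<in>Poly_Mapping.keys m. c x ^ Poly_Mapping.lookup m x) =
        (\<Prod>x\<in>?A. c x ^ Poly_Mapping.lookup m x)"
      by (rule prod.mono_neutral_left) (auto simp: in_keys_iff)
    have "(\<Prod>x\<in>?A. c x ^ Poly_Mapping.lookup e x) = (\<Prod>x\<in>?A. if x = i then c x else 1)"
      by (rule prod.cong) (auto simp: e)
    also have "\<dots> = c i"
      by (subst prod.delta) auto
    finally show ?thesis
      unfolding keys lookup_add power_add prod.distrib 1 by (simp only: mult.commute)
  qed
  have "homogeneous_function (Suc d) I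
      (\<lambda>c. \<Sum>m\<in>Poly_Mapping.keys P. Poly_Mapping.lookup P m *
           (\<Prod>x \<in> Poly_Mapping.keys (m + e). c x ^ Poly_Mapping.lookup (m + e) x))"
    by (rule homogeneous_function_sum, rule homogeneous_function_monomial)
      (use P \<open>i \<in> I\<close> in \<open>auto simp: homogeneous_def vars_def keys deg[unfolded keys] simp del: sum.insert\<close>)
  moreover have "c i * f c = (\<Sum>m\<in>Poly_Mapping.keys P. Poly_Mapping.lookup P m *
           (\<Prod>x \<in> Poly_Mapping.keys (m + e). c x ^ Poly_Mapping.lookup (m + e) x))" for c
    unfolding val P(3) eval_map_def sum_distrib_left id_def
    by (rule sum.cong[OF refl], rule mult.left_commute)
  ultimately show ?thesis by presburger
qed

lemma homogeneous_function_linear_power_mult: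
  assumes "homogeneous_function d I f"
  shows "homogeneous_function (d + k) I (\<lambda>c. (\<Sum>i\<in>I. a i * c i) ^ k * f c)"
proof (induction k)
  case (Suc k)
  have "homogeneous_function (Suc (d + k)) I
      (\<lambda>c. \<Sum>i\<in>I. a i * (c i * ((\<Sum>i\<in>I. a i * c i) ^ k * f c)))"
    by (intro homogeneous_function_sum homogeneous_function_cmult
        homogeneous_function_variable_mult Suc.IH)
  then show ?case by (simp add: sum_distrib_right mult.assoc)
qed (use assms in simp)

text \<open>
  Homogeneous polynomials stay homogeneous of the same degree under linear changes of variables:
  every monomial becomes a product of powers of linear forms, and multiplication by one linear form
  raises the degree by one.
\<close>

lemma homogeneous_function_linear_substitution:
  assumes "homogeneous_function d I f"
  shows "homogeneous_function d J (\<lambda>c. f (\<lambda>i. \<Sum>j\<in>J. M i j * c j))"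
proof -
  obtain P where P: "homogeneous d P" "vars P \<subseteq> I" "\<And>c. f c = eval_map id P c"
    using assms by (auto simp: homogeneous_function_def)
  have one: "homogeneous_function 0 J (\<lambda>c. 1)"
    using homogeneous_function_monomial[of 0 J 0 1] by simp
  have prod: "homogeneous_function (\<Sum>x\<in>A. e x) J (\<lambda>c. \<Prod>x\<in>A. (\<Sum>j\<in>J. M x j * c j) ^ e x)"
    for A and e :: "_ \<Rightarrow> nat"
  proof (induction A rule: infinite_finite_induct)
    case (insert x A)
    then show ?case
      using homogeneous_function_linear_power_mult[OF insert.IH, of "e x" "M x"]
      by (simp add: add.commute)
  qed (use one in auto)
  have "homogeneous_function d J (\<lambda>c. \<Prod>x\<in>Poly_Mapping.keys m.
      (\<Sum>j\<in>J. M x j * c j) ^ Poly_Mapping.lookup m x)" if "m \<in> Poly_Mapping.keys P" for m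
  proof -
    have "(\<Sum>x\<in>Poly_Mapping.keys m. Poly_Mapping.lookup m x) = d"
      using P(1) that by (simp add: homogeneous_def)
    then show ?thesis
      using prod[of "Poly_Mapping.lookup m" "Poly_Mapping.keys m"] by simp
  qed
  then show ?thesis
    unfolding P(3) eval_map_def
    by (intro homogeneous_function_sum homogeneous_function_cmult) auto
qed

text \<open>
  This form is used to compare coefficients: a form restricted to the plane spanned by two vectors
  is a homogeneous polynomial in the two coordinates.
\<close>

lemma homogeneous_function_two_variables:
  assumes "homogeneous_function d {x, y} f" and "x \<noteq> y"
  shows "\<exists>C. \<forall>c. f c = (\<Sum>i\<le>d. C i * c x ^ i * c y ^ (d - i))"
proof -
  obtain P where P: "homogeneous d P" "vars P \<subseteq> {x, y}" "\<And>c. f c = eval_map id P c"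
    using assms by (auto simp: homogeneous_function_def)
  let ?K = "Poly_Mapping.keys P"
  have sub: "Poly_Mapping.keys m \<subseteq> {x, y}" if "m \<in> ?K" for m
    using P(2) that by (auto simp: vars_def)
  have deg: "Poly_Mapping.lookup m x + Poly_Mapping.lookup m y = d" if "m \<in> ?K" for m
  proof -
    have "d = (\<Sum>z\<in>Poly_Mapping.keys m. Poly_Mapping.lookup m z)"
      using P(1) that by (simp add: homogeneous_def)
    also have "\<dots> = (\<Sum>z\<in>{x, y}. Poly_Mapping.lookup m z)"
      by (rule sum.mono_neutral_left) (use sub[OF that] in \<open>auto simp: in_keys_iff\<close>)
    finally show ?thesis using \<open>x \<noteq> y\<close> by simp
  qed
  have val: "(\<Prod>z\<in>Poly_Mapping.keys m. c z ^ Poly_Mapping.lookup m z) =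
      c x ^ Poly_Mapping.lookup m x * c y ^ (d - Poly_Mapping.lookup m x)"
    if "m \<in> ?K" for m and c :: "_ \<Rightarrow> 'b"
  proof -
    have "(\<Prod>z\<in>Poly_Mapping.keys m. c z ^ Poly_Mapping.lookup m z) =
        (\<Prod>z\<in>{x, y}. c z ^ Poly_Mapping.lookup m z)"
      by (rule prod.mono_neutral_left) (use sub[OF that] in \<open>auto simp: in_keys_iff\<close>)
    moreover have "d - Poly_Mapping.lookup m x = Poly_Mapping.lookup m y"
      using deg[OF that] by simp
    ultimately show ?thesis using \<open>x \<noteq> y\<close> by simp
  qed
  define C where "C i = (\<Sum>m | m \<in> ?K \<and> Poly_Mapping.lookup m x = i. Poly_Mapping.lookup P m)" for i
  have "f c = (\<Sum>i\<le>d. C i * c x ^ i * c y ^ (d - i))" for c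
  proof -
    have "f c = (\<Sum>m\<in>?K. Poly_Mapping.lookup P m *
        (c x ^ Poly_Mapping.lookup m x * c y ^ (d - Poly_Mapping.lookup m x)))"
      by (simp add: P(3) eval_map_def val)
    also have "\<dots> = (\<Sum>i\<le>d. \<Sum>m | m \<in> ?K \<and> Poly_Mapping.lookup m x = i. Poly_Mapping.lookup P m *
        (c x ^ Poly_Mapping.lookup m x * c y ^ (d - Poly_Mapping.lookup m x)))"
      by (rule sum.group[symmetric]) (use deg in force)+
    also have "\<dots> = (\<Sum>i\<le>d. C i * c x ^ i * c y ^ (d - i))"
      by (auto simp: C_def sum_distrib_right mult.assoc intro!: sum.cong)
    finally show ?thesis .
  qed
  then show ?thesis by blast
qed

section \<open>Forms as polynomial functions\<close>

text \<open>
  What remains of a form when the polynomial is forgotten: the vector space and an arbitrary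
  function on it. Orthogonal projections and similitudes make sense in this generality.
\<close>

locale form_space = vector_space "scal \<Phi>" for \<Phi> :: "('a::field, 'v::ab_group_add) form" +
  assumes subspace_fspace: "subspace (fspace \<Phi>)"
begin

lemmas fspace_zero = subspace_0[OF subspace_fspace]
lemmas fspace_add = subspace_add[OF subspace_fspace]
lemmas fspace_diff = subspace_diff[OF subspace_fspace]
lemmas fspace_scale = subspace_scale[OF subspace_fspace]

end

lemma form_space_of_is_form:
  assumes "is_form d \<Phi>"
  shows "form_space \<Phi>"
proof -
  interpret vector_space "scal \<Phi>" using assms by (simp add: is_form_def)
  have "subspace (fspace \<Phi>)"
    using assms unfolding is_form_def is_basis_def by (metis subspace_span)
  then show ?thesis by unfold_locales
qed

text \<open>
  Stated for arbitrary families of vectors, so that changes of basis, restrictions to subspaces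
  and restrictions to planes are all instances.
\<close>

lemma is_form_homogeneous_function:
  assumes "is_form d \<Phi>" and "finite J" and "\<And>j. j \<in> J \<Longrightarrow> v j \<in> fspace \<Phi>"
  shows "homogeneous_function d J (\<lambda>c. val \<Phi> (\<Sum>j\<in>J. scal \<Phi> (c j) (v j)))"
proof -
  obtain n :: nat and b P where b: "is_basis \<Phi> {..<n} b" and P: "represents d \<Phi> {..<n} b P"
    using assms by (auto simp: is_form_def)
  interpret vector_space "scal \<Phi>" using assms by (simp add: is_form_def)
  have "\<exists>u. v j = (\<Sum>i<n. scal \<Phi> (u i) (b i))" if "j \<in> J" for j
  proof -
    have "v j \<in> span (b ` {..<n})" using b assms(3)[OF that] by (simp add: is_basis_def)
    then obtain u where "v j = (\<Sum>x\<in>b ` {..<n}. scal \<Phi> (u x) x)"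
      by (auto simp: span_finite)
    also have "\<dots> = (\<Sum>i<n. scal \<Phi> (u (b i)) (b i))"
      using b by (subst sum.reindex) (auto simp: is_basis_def)
    finally show ?thesis by (rule exI[of _ "\<lambda>i. u (b i)"])
  qed
  then obtain M where M: "\<And>j. j \<in> J \<Longrightarrow> v j = (\<Sum>i<n. scal \<Phi> (M j i) (b i))"
    by metis
  have "(\<Sum>j\<in>J. scal \<Phi> (c j) (v j)) = (\<Sum>i<n. scal \<Phi> (\<Sum>j\<in>J. M j i * c j) (b i))" for c
  proof -
    have "(\<Sum>j\<in>J. scal \<Phi> (c j) (v j)) = (\<Sum>j\<in>J. \<Sum>i<n. scal \<Phi> (M j i * c j) (b i))"
      by (rule sum.cong) (simp_all add: M scale_sum_right mult.commute)
    also have "\<dots> = (\<Sum>i<n. scal \<Phi> (\<Sum>j\<in>J. M j i * c j) (b i))"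
      by (subst sum.swap) (simp add: scale_sum_left)
    finally show ?thesis .
  qed
  then have eq: "val \<Phi> (\<Sum>j\<in>J. scal \<Phi> (c j) (v j)) = eval_map id P (\<lambda>i. \<Sum>j\<in>J. M j i * c j)" for c
    using P by (simp add: represents_def)
  have "homogeneous_function d {..<n} (eval_map id P)"
    using P by (auto simp: homogeneous_function_def represents_def)
  from homogeneous_function_linear_substitution[OF this, of J "\<lambda>i j. M j i"]
  show ?thesis by (simp add: eq)
qed

lemma is_form_on_plane:
  assumes "is_form d \<Phi>" and "r \<in> fspace \<Phi>" and "w \<in> fspace \<Phi>"
  shows "\<exists>C. \<forall>s t. val \<Phi> (scal \<Phi> s r + scal \<Phi> t w) = (\<Sum>i\<le>d. C i * s ^ i * t ^ (d - i))"
proof -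
  have "homogeneous_function d {True, False}
      (\<lambda>c. val \<Phi> (\<Sum>j\<in>{True, False}. scal \<Phi> (c j) (if j then r else w)))"
    by (rule is_form_homogeneous_function) (use assms in auto)
  then obtain C where C: "\<And>c. val \<Phi> (\<Sum>j\<in>{True, False}. scal \<Phi> (c j) (if j then r else w)) =
      (\<Sum>i\<le>d. C i * c True ^ i * c False ^ (d - i))"
    using homogeneous_function_two_variables[of d True False] by auto
  show ?thesis
  proof (intro exI allI)
    fix s t show "val \<Phi> (scal \<Phi> s r + scal \<Phi> t w) = (\<Sum>i\<le>d. C i * s ^ i * t ^ (d - i))"
      using C[of "\<lambda>j. if j then s else t"] by simp
  qed
qed

lemma is_form_zero:
  assumes "is_form d \<Phi>" "d > 0"
  shows "val \<Phi> 0 = 0"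
proof -
  interpret form_space \<Phi> by (rule form_space_of_is_form[OF assms(1)])
  obtain C where C: "\<And>s t. val \<Phi> (scal \<Phi> s 0 + scal \<Phi> t 0) = (\<Sum>i\<le>d. C i * s ^ i * t ^ (d - i))"
    using is_form_on_plane[OF assms(1) fspace_zero fspace_zero] by blast
  have "(\<Sum>i\<le>d. C i * 0 ^ i * 0 ^ (d - i)) = 0"
  proof (rule sum.neutral, rule ballI)
    fix i show "C i * 0 ^ i * 0 ^ (d - i) = 0"
      using \<open>d > 0\<close> by (cases "i = 0") auto
  qed
  then show ?thesis using C[of 0 0] by simp
qed

text \<open>
  Needed to split a form into summands, which must be forms again: a basis of the subspace
  consists of finitely many vectors of the larger space, and the polynomial in the new
  coordinates arises by a linear substitution.
\<close>

lemma is_form_restrict: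
  assumes "is_form d \<Phi>" and S: "module.subspace (scal \<Phi>) S" "S \<subseteq> fspace \<Phi>"
  shows "is_form d (\<Phi>\<lparr>fspace := S\<rparr>)"
proof -
  obtain n :: nat and b P where b: "is_basis \<Phi> {..<n} b"
    using assms by (auto simp: is_form_def)
  interpret vector_space "scal \<Phi>" using assms by (simp add: is_form_def)
  obtain B where B: "B \<subseteq> S" "independent B" "S \<subseteq> span B"
    by (rule basis_exists[of S])
  have S_eq: "span B = S"
    using B S span_minimal[of B S] by blast
  have "finite B"
    using independent_span_bound[of "b ` {..<n}" B] b B S by (auto simp: is_basis_def)
  then obtain b' where "bij_betw b' {..<card B} B"
    using ex_bij_betw_nat_finite[of B] by (auto simp: atLeast0LessThan)
  then have b': "b' ` {..<card B} = B" "inj_on b' {..<card B}"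
    by (auto simp: bij_betw_def)
  then have "is_basis (\<Phi>\<lparr>fspace := S\<rparr>) {..<card B} b'"
    using B(2) by (simp add: is_basis_def S_eq)
  moreover have "homogeneous_function d {..<card B}
      (\<lambda>c. val \<Phi> (\<Sum>j\<in>{..<card B}. scal \<Phi> (c j) (b' j)))"
    by (rule is_form_homogeneous_function) (use assms(1,3) B(1) b'(1) in blast)+
  then obtain P' where "represents d (\<Phi>\<lparr>fspace := S\<rparr>) {..<card B} b' P'"
    by (auto simp: homogeneous_function_def represents_def)
  ultimately show ?thesis
    using vector_space_axioms unfolding is_form_def by auto
qed

section \<open>Polynomials of degree below the characteristic\<close>

text \<open>
  The images of \<open>0, \<dots>, d\<close> in the field are distinct and provide more roots than the degree permits.
\<close>

lemma poly_eq_0_of_all_roots: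
  fixes p :: "'a::field poly"
  assumes inv: "\<And>m. 0 < m \<Longrightarrow> m \<le> d \<Longrightarrow> of_nat m \<noteq> (0::'a)"
    and "degree p \<le> d" and roots: "\<And>x. poly p x = 0"
  shows "p = 0"
proof (rule ccontr)
  assume "p \<noteq> 0"
  have "inj_on (of_nat :: nat \<Rightarrow> 'a) {..d}"
  proof (rule inj_onI)
    have less: False if "i < j" "j \<le> d" "(of_nat i :: 'a) = of_nat j" for i j
    proof -
      have "0 < j - i" "j - i \<le> d" using that by linarith+
      then show False using inv[of "j - i"] that by (simp add: of_nat_diff)
    qed
    fix i j assume "i \<in> {..d}" "j \<in> {..d}" "(of_nat i :: 'a) = of_nat j"
    then show "i = j" using less[of i j] less[of j i] by (metis atMost_iff linorder_neqE_nat)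
  qed
  then have "card (of_nat ` {..d} :: 'a set) = Suc d" by (simp add: card_image)
  moreover have "card (of_nat ` {..d} :: 'a set) \<le> card {x. poly p x = 0}"
    by (rule card_mono) (use poly_roots_finite[OF \<open>p \<noteq> 0\<close>] roots in auto)
  moreover have "card {x. poly p x = 0} \<le> degree p"
    by (rule card_poly_roots_bound[OF \<open>p \<noteq> 0\<close>])
  ultimately show False using \<open>degree p \<le> d\<close> by simp
qed

lemma poly_coeff_sum:
  fixes C :: "nat \<Rightarrow> 'a::comm_semiring_1" and d :: nat
  defines "p \<equiv> (\<Sum>i\<le>d. Polynomial.monom (C i) i)"
  shows "degree p \<le> d" "poly p s = (\<Sum>i\<le>d. C i * s ^ i)" "i \<le> d \<Longrightarrow> coeff p i = C i"
proof -
  show "degree p \<le> d"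
    unfolding p_def by (rule degree_sum_le) (auto intro: order.trans[OF degree_monom_le])
  show "poly p s = (\<Sum>i\<le>d. C i * s ^ i)"
    by (simp add: p_def poly_sum poly_monom)
  show "coeff p i = C i" if "i \<le> d"
    using that by (simp add: p_def coeff_sum if_distrib cong: if_cong)
qed

lemma poly_const_of_derivative_zero:
  fixes p :: "'a::field poly"
  assumes inv: "\<And>m. 0 < m \<Longrightarrow> m \<le> d \<Longrightarrow> of_nat m \<noteq> (0::'a)"
    and deg: "degree p \<le> d" and deriv: "\<And>x. poly (pderiv p) x = 0"
  shows "poly p x = poly p y"
proof -
  have "pderiv p = 0"
  proof (rule poly_eq_0_of_all_roots[OF inv])
    show "degree (pderiv p) \<le> d"
      by (rule degree_le) (use deg in \<open>simp add: coeff_pderiv coeff_eq_0\<close>)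
  qed (use deriv in auto)
  then have "of_nat (Suc n) * coeff p (Suc n) = 0" for n
    unfolding coeff_pderiv[symmetric] by simp
  then have coeff: "coeff p (Suc n) = 0" for n
    using inv[of "Suc n"] deg
    by (cases "Suc n \<le> d") (auto simp: coeff_eq_0 simp del: of_nat_Suc)
  have "degree p = 0"
  proof (rule ccontr)
    assume "degree p \<noteq> 0"
    then obtain n where "degree p = Suc n" by (cases "degree p") auto
    then show False using coeff[of n] leading_coeff_0_iff[of p] by auto
  qed
  then obtain a where "p = [:a:]" by (rule degree_eq_zeroE)
  then show ?thesis by simp
qed

text \<open>
  The coefficient of \<open>t\<close> in \<open>(1 + t)\<^sup>d - 1 - t\<^sup>d\<close> is \<open>d\<close>, which is invertible, and a nonzero
  polynomial of degree at most \<open>d\<close> does not vanish everywhere.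
\<close>

lemma exists_nonadditive_power:
  fixes d :: nat
  assumes inv: "\<And>m. 0 < m \<Longrightarrow> m \<le> d \<Longrightarrow> of_nat m \<noteq> (0::'a::field)" and "2 \<le> d"
  shows "\<exists>t::'a. (1 + t) ^ d - 1 - t ^ d \<noteq> 0"
proof (rule ccontr)
  assume "\<not> ?thesis"
  then have eq: "(1 + t) ^ d - 1 - t ^ d = 0" for t :: 'a by blast
  define p :: "'a poly" where "p = [:1, 1:] ^ d - 1 - Polynomial.monom 1 d"
  have "p = 0"
  proof (rule poly_eq_0_of_all_roots[OF inv])
    show "degree p \<le> d" unfolding p_def
      by (intro degree_diff_le) (auto simp: degree_linear_power degree_monom_eq)
    show "poly p x = 0" for x using eq[of x] by (simp add: p_def poly_monom)
  qed
  have "coeff ([:1, 1:] ^ n) 0 = (1::'a) \<and> coeff ([:1, 1:] ^ n) (Suc 0) = (of_nat n :: 'a)" for n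
    by (induction n) (auto simp: coeff_pCons)
  then have "coeff ([:1, 1:] ^ d) (Suc 0) = (of_nat d :: 'a)" by blast
  then have "coeff p (Suc 0) = of_nat d"
    using \<open>2 \<le> d\<close> unfolding p_def coeff_diff coeff_monom by simp
  then show False using \<open>p = 0\<close> inv[of d] \<open>2 \<le> d\<close> by simp
qed

section \<open>Directions along which a form is constant\<close>

text \<open>
  For a form, the part of the second difference that is bilinear in \<open>x\<close> and \<open>y\<close> is
  \<open>d (d - 1) \<theta>(x, y, w, \<dots>, w)\<close>, for the associated symmetric multilinear form \<open>\<theta>\<close>.
\<close>

definition second_difference :: "('v::ab_group_add \<Rightarrow> 'a::ab_group_add) \<Rightarrow> 'v \<Rightarrow> 'v \<Rightarrow> 'v \<Rightarrow> 'a" where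
  "second_difference q x y w = q (x + y + w) - q (x + w) - q (y + w) + q w"

text \<open>
  Here \<open>C 1\<close> is the derivative of the form at \<open>w\<close> in direction \<open>r\<close>. In the expansion of
  \<open>val \<Phi> (s r + t w)\<close> its monomial is \<open>s t\<^sup>d\<^sup>-\<^sup>1\<close>. Because \<open>d - 1 \<ge> 2\<close>, this monomial is not additive in
  \<open>t\<close>, so it cannot occur in \<open>val \<Phi> (s r + t w) - val \<Phi> (t w)\<close>, which by assumption is additive in
  \<open>t\<close> up to a constant. This is where \<open>d \<ge> 3\<close> enters.
\<close>

lemma linear_coefficient_vanishes:
  fixes \<Phi> :: "('a::field, 'v::ab_group_add) form"
  assumes form: "is_form d \<Phi>" and "3 \<le> d"
    and inv: "\<And>m. 0 < m \<Longrightarrow> m \<le> d \<Longrightarrow> of_nat m \<noteq> (0::'a)"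
    and r: "r \<in> fspace \<Phi>" and w: "w \<in> fspace \<Phi>"
    and affine: "\<And>s y z. y \<in> fspace \<Phi> \<Longrightarrow> z \<in> fspace \<Phi> \<Longrightarrow>
      second_difference (\<lambda>v. val \<Phi> (scal \<Phi> s r + v) - val \<Phi> v) y z 0 = 0"
    and C: "\<And>s t. val \<Phi> (scal \<Phi> s r + scal \<Phi> t w) = (\<Sum>i\<le>d. C i * s ^ i * t ^ (d - i))"
  shows "C 1 = 0"
proof -
  interpret form_space \<Phi> by (rule form_space_of_is_form[OF form])
  have "\<exists>t::'a. (1 + t) ^ (d - 1) - 1 - t ^ (d - 1) \<noteq> 0"
    by (rule exists_nonadditive_power) (use inv \<open>3 \<le> d\<close> in auto)
  then obtain t :: 'a where t: "(1 + t) ^ (d - 1) - 1 - t ^ (d - 1) \<noteq> 0" by blast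
  define D where "D i = C i * ((1 + t) ^ (d - i) - 1 - t ^ (d - i) + 0 ^ (d - i))" for i
  have D: "(\<Sum>i\<le>d. D i * s ^ i) = val \<Phi> (scal \<Phi> s r + scal \<Phi> (1 + t) w)
      - val \<Phi> (scal \<Phi> s r + scal \<Phi> 1 w) - val \<Phi> (scal \<Phi> s r + scal \<Phi> t w)
      + val \<Phi> (scal \<Phi> s r + scal \<Phi> 0 w)" for s
    unfolding C D_def by (simp add: sum_subtractf sum.distrib algebra_simps)
  have const: "(\<Sum>i\<le>d. D i * s ^ i) = (\<Sum>i\<le>d. D i * 0 ^ i)" for s
    using affine[of w "scal \<Phi> t w" s] w
    unfolding D by (simp add: second_difference_def fspace_scale scale_left_distrib algebra_simps)
  define p where "p = (\<Sum>i\<le>d. Polynomial.monom (D i) i)"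
  have "p - [:D 0:] = 0"
  proof (rule poly_eq_0_of_all_roots[OF inv])
    show "degree (p - [:D 0:]) \<le> d"
      by (rule degree_diff_le) (auto simp: p_def poly_coeff_sum)
    have "(\<Sum>i\<le>d. D i * 0 ^ i) = D 0"
      by (subst sum.atMost_shift) simp
    then show "poly (p - [:D 0:]) s = 0" for s
      using const[of s] by (simp add: p_def poly_coeff_sum(2))
  qed
  then have "coeff p 1 = 0"
    using arg_cong[of _ _ "\<lambda>q. coeff q 1", OF \<open>p - [:D 0:] = 0\<close>] by simp
  then have "D 1 = 0"
    using poly_coeff_sum(3)[of 1 d D] \<open>3 \<le> d\<close> unfolding p_def by simp
  moreover have "(0::'a) ^ (d - 1) = 0" using \<open>3 \<le> d\<close> by simp
  ultimately have "C 1 * ((1 + t) ^ (d - 1) - 1 - t ^ (d - 1)) = 0"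
    unfolding D_def by (simp only: add_0_right)
  then show ?thesis
    using t by (simp only: mult_eq_0_iff simp_thms)
qed

text \<open>
  The previous lemma applies at every point \<open>s\<^sub>0 r + w\<close> of the line through \<open>w\<close> in direction \<open>r\<close>.
  So the restriction of the form to this line is a polynomial of degree at most \<open>d\<close> with
  derivative zero, and it is constant since \<open>1, \<dots>, d\<close> are invertible.
\<close>

lemma val_translation_invariant:
  fixes \<Phi> :: "('a::field, 'v::ab_group_add) form"
  assumes form: "is_form d \<Phi>" and "3 \<le> d"
    and inv: "\<And>m. 0 < m \<Longrightarrow> m \<le> d \<Longrightarrow> of_nat m \<noteq> (0::'a)"
    and r: "r \<in> fspace \<Phi>" and w: "w \<in> fspace \<Phi>"
    and affine: "\<And>s y z. y \<in> fspace \<Phi> \<Longrightarrow> z \<in> fspace \<Phi> \<Longrightarrow>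
      second_difference (\<lambda>v. val \<Phi> (scal \<Phi> s r + v) - val \<Phi> v) y z 0 = 0"
  shows "val \<Phi> (scal \<Phi> s r + w) = val \<Phi> w"
proof -
  interpret form_space \<Phi> by (rule form_space_of_is_form[OF form])
  obtain C where C: "\<And>s t. val \<Phi> (scal \<Phi> s r + scal \<Phi> t w) = (\<Sum>i\<le>d. C i * s ^ i * t ^ (d - i))"
    using is_form_on_plane[OF form r w] by blast
  define p where "p = (\<Sum>i\<le>d. Polynomial.monom (C i) i)"
  have p: "poly p s = val \<Phi> (scal \<Phi> s r + w)" for s
    using C[of s 1] by (simp add: p_def poly_coeff_sum(2))
  have deg: "degree p \<le> d" by (simp add: p_def poly_coeff_sum)
  have deriv: "poly (pderiv p) s\<^sub>0 = 0" for s\<^sub>0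
  proof -
    have w': "scal \<Phi> s\<^sub>0 r + w \<in> fspace \<Phi>" using r w by (simp add: fspace_add fspace_scale)
    obtain C' where C': "\<And>s t. val \<Phi> (scal \<Phi> s r + scal \<Phi> t (scal \<Phi> s\<^sub>0 r + w)) =
        (\<Sum>i\<le>d. C' i * s ^ i * t ^ (d - i))"
      using is_form_on_plane[OF form r w'] by blast
    have C'1: "C' 1 = 0"
      by (rule linear_coefficient_vanishes[OF form \<open>3 \<le> d\<close> inv r w' affine C'])
    define p' where "p' = (\<Sum>i\<le>d. Polynomial.monom (C' i) i)"
    have "p' - pcompose p [:s\<^sub>0, 1:] = 0"
    proof (rule poly_eq_0_of_all_roots[OF inv])
      have "degree (pcompose p [:s\<^sub>0, 1:]) \<le> d"
        using degree_pcompose_le[of p "[:s\<^sub>0, 1:]"] deg by simp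
      then show "degree (p' - pcompose p [:s\<^sub>0, 1:]) \<le> d"
        by (intro degree_diff_le) (auto simp: p'_def poly_coeff_sum)
      have "poly p' s = poly p (s\<^sub>0 + s)" for s
        using C'[of s 1]
        by (simp add: p p'_def poly_coeff_sum(2) scale_left_distrib algebra_simps)
      then show "poly (p' - pcompose p [:s\<^sub>0, 1:]) s = 0" for s
        by (simp add: poly_pcompose)
    qed
    then have "pcompose p [:s\<^sub>0, 1:] = p'" by simp
    then have "coeff (pcompose p [:s\<^sub>0, 1:]) 1 = 0"
      using C'1 \<open>3 \<le> d\<close> poly_coeff_sum(3)[of 1 d C'] unfolding p'_def by simp
    moreover have "poly (pderiv q) 0 = coeff q 1" for q :: "'a poly"
      by (simp add: poly_0_coeff_0 coeff_pderiv)
    moreover have "poly (pderiv (pcompose p [:s\<^sub>0, 1:])) 0 = poly (pderiv p) s\<^sub>0"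
      by (simp add: pderiv_pcompose poly_pcompose pderiv_pCons)
    ultimately show ?thesis by metis
  qed
  have "poly p s = poly p 0"
    by (rule poly_const_of_derivative_zero[of d]) (use inv deg deriv in auto)
  then show ?thesis by (simp add: p)
qed

section \<open>Orthogonal projections\<close>

text \<open>
  Idempotent endomorphisms whose image and kernel are orthogonal to each other: since
  \<open>x - e x\<close> runs through the kernel of \<open>e\<close>, the condition on \<open>val\<close> says that the form is the
  orthogonal sum of its restrictions to image and kernel.
\<close>

definition orthogonal_projection ::
  "('a::field, 'v::ab_group_add) form \<Rightarrow> ('v \<Rightarrow> 'v) \<Rightarrow> bool" where
  "orthogonal_projection \<Phi> e \<longleftrightarrow>
     (\<forall>x\<in>fspace \<Phi>. e x \<in> fspace \<Phi> \<and> e (e x) = e x \<and> val \<Phi> x = val \<Phi> (e x) + val \<Phi> (x - e x)) \<and>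
     (\<forall>x\<in>fspace \<Phi>. \<forall>y\<in>fspace \<Phi>. e (x + y) = e x + e y) \<and>
     (\<forall>a. \<forall>x\<in>fspace \<Phi>. e (scal \<Phi> a x) = scal \<Phi> a (e x))"

context form_space
begin

lemma projection_diff:
  assumes "orthogonal_projection \<Phi> e" "x \<in> fspace \<Phi>" "y \<in> fspace \<Phi>"
  shows "e (x - y) = e x - e y"
proof -
  have "e x = e ((x - y) + y)" by simp
  also have "\<dots> = e (x - y) + e y"
    using assms fspace_diff unfolding orthogonal_projection_def by blast
  finally show ?thesis by simp
qed

lemma projection_zero:
  assumes "orthogonal_projection \<Phi> e"
  shows "e 0 = 0"
  using projection_diff[OF assms fspace_zero fspace_zero] by simp

text \<open>
  Substitute for \<open>\<theta>(e x, y, \<dots>) = \<theta>(x, e y, \<dots>)\<close>. On each side only one of the two increments has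
  a component in the kernel of \<open>e\<close>, so the contributions of the kernel cancel, and both sides
  are equal to the second difference at \<open>e w\<close> for the increments \<open>e x\<close> and \<open>e y\<close>.
\<close>

lemma second_difference_projection:
  assumes e: "orthogonal_projection \<Phi> e"
    and x: "x \<in> fspace \<Phi>" and y: "y \<in> fspace \<Phi>" and w: "w \<in> fspace \<Phi>"
  shows "second_difference (val \<Phi>) (e x) y w = second_difference (val \<Phi>) x (e y) w"
proof -
  have mem: "e u \<in> fspace \<Phi>" if "u \<in> fspace \<Phi>" for u
    using e that unfolding orthogonal_projection_def by blast
  have add: "e (u + v) = e u + e v" if "u \<in> fspace \<Phi>" "v \<in> fspace \<Phi>" for u v
    using e that unfolding orthogonal_projection_def by blast
  have idem: "e (e u) = e u" if "u \<in> fspace \<Phi>" for u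
    using e that unfolding orthogonal_projection_def by blast
  have split: "val \<Phi> u = val \<Phi> (e u) + val \<Phi> (u - e u)" if "u \<in> fspace \<Phi>" for u
    using e that unfolding orthogonal_projection_def by blast
  note * = mem add idem fspace_add x y w
  have "val \<Phi> (e x + y + w) = val \<Phi> (e x + e y + e w) + val \<Phi> (y - e y + (w - e w))"
    using split[of "e x + y + w"] by (simp add: * add_diff_add)
  moreover have "val \<Phi> (e x + w) = val \<Phi> (e x + e w) + val \<Phi> (w - e w)"
    using split[of "e x + w"] by (simp add: *)
  moreover have "val \<Phi> (y + w) = val \<Phi> (e y + e w) + val \<Phi> (y - e y + (w - e w))"
    using split[of "y + w"] by (simp add: * add_diff_add)
  moreover have "val \<Phi> (x + e y + w) = val \<Phi> (e x + e y + e w) + val \<Phi> (x - e x + (w - e w))"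
    using split[of "x + e y + w"] by (simp add: * add_diff_add)
  moreover have "val \<Phi> (x + w) = val \<Phi> (e x + e w) + val \<Phi> (x - e x + (w - e w))"
    using split[of "x + w"] by (simp add: * add_diff_add)
  moreover have "val \<Phi> (e y + w) = val \<Phi> (e y + e w) + val \<Phi> (w - e w)"
    using split[of "e y + w"] by (simp add: *)
  ultimately show ?thesis
    unfolding second_difference_def by (simp add: algebra_simps)
qed

end

text \<open>
  Both sides are the third difference with increments \<open>x\<close>, \<open>y\<close>, \<open>z\<close> at \<open>w\<close>, which is symmetric.
\<close>

lemma third_difference_swap:
  "second_difference q x y (w + z) - second_difference q x y w =
   second_difference q x z (w + y) - second_difference q x z w"
  by (simp add: second_difference_def algebra_simps)

text \<open>
  With three increments available, \<open>e\<close> and \<open>f\<close> can be moved off \<open>x\<close> in one order and back in the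
  other order. So \<open>e (f x)\<close> and \<open>f (e x)\<close> have the same third differences with \<open>y\<close> and \<open>z\<close>, and
  this is the assertion about \<open>r\<close> after a shift of the base point.
\<close>

lemma (in form_space) commutator_affine:
  assumes e: "orthogonal_projection \<Phi> e" and f: "orthogonal_projection \<Phi> f"
    and x: "x \<in> fspace \<Phi>" and y: "y \<in> fspace \<Phi>" and z: "z \<in> fspace \<Phi>"
  defines "r \<equiv> e (f x) - f (e x)"
  shows "second_difference (\<lambda>v. val \<Phi> (r + v) - val \<Phi> v) y z 0 = 0"
proof -
  have mem: "e u \<in> fspace \<Phi>" "f u \<in> fspace \<Phi>" if "u \<in> fspace \<Phi>" for u
    using e f that unfolding orthogonal_projection_def by blast+
  \<comment> \<open>At this base point \<open>f (e x) + w = 0\<close> and \<open>e (f x) + w = r\<close>; terms that contain neither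
    \<open>f (e x)\<close> nor \<open>e (f x)\<close> are the same on both sides.\<close>
  define w where "w = - f (e x)"
  have w: "w \<in> fspace \<Phi>" using fspace_diff[OF fspace_zero mem(2)[OF mem(1)[OF x]]] by (simp add: w_def)
  note sp = second_difference_projection
  let ?D = "\<lambda>u y z. second_difference (val \<Phi>) u y (w + z) - second_difference (val \<Phi>) u y w"
  have De: "?D (e u) b c = ?D u (e b) c" if "u \<in> fspace \<Phi>" "b \<in> fspace \<Phi>" "c \<in> fspace \<Phi>" for u b c
    using sp[OF e] that w by (simp add: fspace_add)
  have Df: "?D (f u) b c = ?D u (f b) c" if "u \<in> fspace \<Phi>" "b \<in> fspace \<Phi>" "c \<in> fspace \<Phi>" for u b c
    using sp[OF f] that w by (simp add: fspace_add)
  have swap: "?D u b c = ?D u c b" for u b c by (rule third_difference_swap)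
  have "?D (e (f x)) y z = ?D (f x) (e y) z" using De x y z mem by blast
  also have "\<dots> = ?D (f x) z (e y)" by (rule swap)
  also have "\<dots> = ?D x (f z) (e y)" using Df x y z mem by blast
  also have "\<dots> = ?D x (e y) (f z)" by (rule swap)
  also have "\<dots> = ?D (e x) y (f z)" using De[of x y "f z"] x y z mem by simp
  also have "\<dots> = ?D (e x) (f z) y" by (rule swap)
  also have "\<dots> = ?D (f (e x)) z y" using Df[of "e x" z y] x y z mem by simp
  also have "\<dots> = ?D (f (e x)) y z" by (rule swap)
  finally have "?D (e (f x)) y z = ?D (f (e x)) y z" .
  then show ?thesis
    by (simp add: second_difference_def r_def w_def algebra_simps)
qed

section \<open>Indecomposable forms\<close>

text \<open>
  Otherwise image and kernel of the projection are both nonzero and decompose the form.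
\<close>

lemma indecomposable_projection:
  assumes form: "is_form d \<Phi>" and "indecomposable d \<Phi>" and e: "orthogonal_projection \<Phi> e"
  shows "(\<forall>x\<in>fspace \<Phi>. e x = 0) \<or> (\<forall>x\<in>fspace \<Phi>. e x = x)"
proof (rule ccontr)
  assume not: "\<not> ?thesis"
  interpret form_space \<Phi> by (rule form_space_of_is_form[OF form])
  have mem: "e x \<in> fspace \<Phi>" and idem: "e (e x) = e x"
    and split: "val \<Phi> x = val \<Phi> (e x) + val \<Phi> (x - e x)" if "x \<in> fspace \<Phi>" for x
    using e that unfolding orthogonal_projection_def by blast+
  have add: "e (x + y) = e x + e y" if "x \<in> fspace \<Phi>" "y \<in> fspace \<Phi>" for x y
    using e that unfolding orthogonal_projection_def by blast
  have scale: "e (scal \<Phi> a x) = scal \<Phi> a (e x)" if "x \<in> fspace \<Phi>" for a x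
    using e that unfolding orthogonal_projection_def by blast
  define S\<^sub>1 where "S\<^sub>1 = {x \<in> fspace \<Phi>. e x = x}"
  define S\<^sub>2 where "S\<^sub>2 = {x \<in> fspace \<Phi>. e x = 0}"
  have "subspace S\<^sub>1"
    by (rule subspaceI)
      (auto simp: S\<^sub>1_def fspace_zero fspace_add fspace_scale add scale projection_zero[OF e])
  then have form1: "is_form d (\<Phi>\<lparr>fspace := S\<^sub>1\<rparr>)"
    by (rule is_form_restrict[OF form]) (auto simp: S\<^sub>1_def)
  have "subspace S\<^sub>2"
    by (rule subspaceI)
      (auto simp: S\<^sub>2_def fspace_zero fspace_add fspace_scale add scale projection_zero[OF e])
  then have form2: "is_form d (\<Phi>\<lparr>fspace := S\<^sub>2\<rparr>)"
    by (rule is_form_restrict[OF form]) (auto simp: S\<^sub>2_def)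
  have in1: "e x \<in> S\<^sub>1" and in2: "x - e x \<in> S\<^sub>2" if "x \<in> fspace \<Phi>" for x
    using that by (simp_all add: S\<^sub>1_def S\<^sub>2_def mem idem fspace_diff projection_diff[OF e])
  obtain x\<^sub>1 x\<^sub>2 where x: "x\<^sub>1 \<in> fspace \<Phi>" "e x\<^sub>1 \<noteq> 0" "x\<^sub>2 \<in> fspace \<Phi>" "e x\<^sub>2 \<noteq> x\<^sub>2"
    using not by blast
  have ne: "S\<^sub>1 \<noteq> {0}" "S\<^sub>2 \<noteq> {0}"
    using in1[OF x(1)] in2[OF x(3)] x by auto
  have "\<Phi> \<cong>\<^sub>F orth_sum (\<Phi>\<lparr>fspace := S\<^sub>1\<rparr>) (\<Phi>\<lparr>fspace := S\<^sub>2\<rparr>)"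
    unfolding form_iso_def
  proof (intro exI[of _ "\<lambda>x. (e x, x - e x)"] conjI ballI allI)
    show "bij_betw (\<lambda>x. (e x, x - e x)) (fspace \<Phi>)
        (fspace (orth_sum (\<Phi>\<lparr>fspace := S\<^sub>1\<rparr>) (\<Phi>\<lparr>fspace := S\<^sub>2\<rparr>)))"
    proof (rule bij_betw_byWitness[where f' = "\<lambda>(u, v). u + v"])
      show "\<forall>a'\<in>fspace (orth_sum (\<Phi>\<lparr>fspace := S\<^sub>1\<rparr>) (\<Phi>\<lparr>fspace := S\<^sub>2\<rparr>)).
          (\<lambda>x. (e x, x - e x)) ((\<lambda>(u, v). u + v) a') = a'"
        by (auto simp: orth_sum_def S\<^sub>1_def S\<^sub>2_def add)
    qed (auto simp: orth_sum_def in1 in2, auto simp: S\<^sub>1_def S\<^sub>2_def fspace_add)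
  qed (auto simp: orth_sum_def add scale split[symmetric] scale_right_diff_distrib)
  moreover have "fspace (\<Phi>\<lparr>fspace := S\<^sub>1\<rparr>) \<noteq> {0}" "fspace (\<Phi>\<lparr>fspace := S\<^sub>2\<rparr>) \<noteq> {0}"
    using ne by simp_all
  moreover have "nonzero_form \<Phi>"
    using \<open>indecomposable d \<Phi>\<close> by (simp add: indecomposable_def)
  ultimately have "decomposable d \<Phi>"
    unfolding decomposable_def using form1 form2 by blast
  then show False using \<open>indecomposable d \<Phi>\<close> by (simp add: indecomposable_def)
qed

text \<open>
  The form vanishes on the line through \<open>r\<close> and does not change under translation along it. Hence
  every linear projection onto this line is orthogonal.
\<close>

lemma indecomposable_radical_trivial:
  assumes form: "is_form d \<Phi>" and "d > 0" and ind: "indecomposable d \<Phi>" and r: "r \<in> fspace \<Phi>"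
    and invariant: "\<And>s w. w \<in> fspace \<Phi> \<Longrightarrow> val \<Phi> (scal \<Phi> s r + w) = val \<Phi> w"
  shows "r = 0"
proof (rule ccontr)
  assume "r \<noteq> 0"
  interpret form_space \<Phi> by (rule form_space_of_is_form[OF form])
  have line: "val \<Phi> (scal \<Phi> s r) = 0" for s
    using invariant[OF fspace_zero, of s] is_form_zero[OF form \<open>d > 0\<close>] by simp
  have "independent {r}" using \<open>r \<noteq> 0\<close> by simp
  \<comment> \<open>The coordinate of \<open>r\<close> in a basis of the ambient space that contains \<open>r\<close> is a
    linear functional with value \<open>1\<close> at \<open>r\<close>.\<close>
  define B where "B = extend_basis {r}"
  have B: "independent B" "r \<in> B" "span B = UNIV"
    using independent_extend_basis[OF \<open>independent {r}\<close>] span_extend_basis[OF \<open>independent {r}\<close>]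
      extend_basis_superset[OF \<open>independent {r}\<close>]
    by (simp_all add: B_def)
  define e where "e x = scal \<Phi> (representation B x r) r" for x
  have r1: "e r = r"
    using representation_basis[OF B(1,2)] by (simp add: e_def)
  have scale: "e (scal \<Phi> a x) = scal \<Phi> a (e x)" for a x
    using representation_scale[OF B(1)] B(3) by (simp add: e_def)
  have "orthogonal_projection \<Phi> e"
    unfolding orthogonal_projection_def
  proof (intro conjI ballI allI)
    fix x assume x: "x \<in> fspace \<Phi>"
    show mem: "e x \<in> fspace \<Phi>" using r by (simp add: e_def fspace_scale)
    have "e (e x) = scal \<Phi> (representation B x r) (e r)"
      unfolding e_def[of x] by (rule scale)
    then show "e (e x) = e x" unfolding r1 by (simp only: e_def[of x])
    show "val \<Phi> x = val \<Phi> (e x) + val \<Phi> (x - e x)"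
      using invariant[OF fspace_diff[OF x mem], of "representation B x r"] line
      by (simp add: e_def)
    fix y show "e (x + y) = e x + e y"
      using representation_add[OF B(1)] B(3) by (simp add: e_def scale_left_distrib)
  qed (rule scale)
  from indecomposable_projection[OF form ind this]
  show False
  proof
    assume "\<forall>x\<in>fspace \<Phi>. e x = 0"
    then show False using r r1 \<open>r \<noteq> 0\<close> by auto
  next
    assume id: "\<forall>x\<in>fspace \<Phi>. e x = x"
    have "val \<Phi> x = 0" if "x \<in> fspace \<Phi>" for x
      using bspec[OF id that] line[of "representation B x r"] by (simp add: e_def)
    then show False using ind by (simp add: indecomposable_def nonzero_form_def)
  qed
qed

section \<open>Isomorphisms\<close>

lemma form_iso_trans:
  assumes "\<Phi> \<cong>\<^sub>F \<Psi>" "\<Psi> \<cong>\<^sub>F X"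
  shows "\<Phi> \<cong>\<^sub>F X"
proof -
  obtain f where f: "bij_betw f (fspace \<Phi>) (fspace \<Psi>)"
    "\<forall>u\<in>fspace \<Phi>. \<forall>v\<in>fspace \<Phi>. f (u + v) = f u + f v"
    "\<forall>a. \<forall>v\<in>fspace \<Phi>. f (scal \<Phi> a v) = scal \<Psi> a (f v)"
    "\<forall>v\<in>fspace \<Phi>. val \<Psi> (f v) = val \<Phi> v"
    using assms(1) unfolding form_iso_def by blast
  obtain g where g: "bij_betw g (fspace \<Psi>) (fspace X)"
    "\<forall>u\<in>fspace \<Psi>. \<forall>v\<in>fspace \<Psi>. g (u + v) = g u + g v"
    "\<forall>a. \<forall>v\<in>fspace \<Psi>. g (scal \<Psi> a v) = scal X a (g v)"
    "\<forall>v\<in>fspace \<Psi>. val X (g v) = val \<Psi> v"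
    using assms(2) unfolding form_iso_def by blast
  have mem: "f v \<in> fspace \<Psi>" if "v \<in> fspace \<Phi>" for v
    using f(1) that by (auto dest: bij_betwE)
  show ?thesis unfolding form_iso_def
  proof (intro exI[of _ "g \<circ> f"] conjI)
    show "bij_betw (g \<circ> f) (fspace \<Phi>) (fspace X)" by (rule bij_betw_trans[OF f(1) g(1)])
  qed (use f g mem in auto)
qed

lemma form_iso_sym:
  assumes "form_space \<Phi>" "\<Phi> \<cong>\<^sub>F \<Psi>"
  shows "\<Psi> \<cong>\<^sub>F \<Phi>"
proof -
  interpret form_space \<Phi> by fact
  obtain f where f: "bij_betw f (fspace \<Phi>) (fspace \<Psi>)"
    "\<And>u v. u \<in> fspace \<Phi> \<Longrightarrow> v \<in> fspace \<Phi> \<Longrightarrow> f (u + v) = f u + f v"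
    "\<And>a v. v \<in> fspace \<Phi> \<Longrightarrow> f (scal \<Phi> a v) = scal \<Psi> a (f v)"
    "\<And>v. v \<in> fspace \<Phi> \<Longrightarrow> val \<Psi> (f v) = val \<Phi> v"
    using assms(2) unfolding form_iso_def by blast
  define g where "g = inv_into (fspace \<Phi>) f"
  have g: "bij_betw g (fspace \<Psi>) (fspace \<Phi>)"
    using bij_betw_inv_into[OF f(1)] by (simp add: g_def)
  have mem: "g x \<in> fspace \<Phi>" and fg: "f (g x) = x" if "x \<in> fspace \<Psi>" for x
    using that f(1) g bij_betw_inv_into_right[OF f(1)] by (auto simp: g_def dest: bij_betwE)
  have gf: "g (f x) = x" if "x \<in> fspace \<Phi>" for x
    using that bij_betw_inv_into_left[OF f(1)] by (simp add: g_def)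
  show ?thesis unfolding form_iso_def
  proof (intro exI[of _ g] conjI ballI allI)
    show "bij_betw g (fspace \<Psi>) (fspace \<Phi>)" by (rule g)
    fix u assume u: "u \<in> fspace \<Psi>"
    show "val \<Phi> (g u) = val \<Psi> u" using f(4)[OF mem[OF u]] fg[OF u] by simp
    show "g (scal \<Psi> a u) = scal \<Phi> a (g u)" for a
      using gf[OF fspace_scale[OF mem[OF u]]] f(3)[OF mem[OF u]] fg[OF u] by simp
    fix v assume v: "v \<in> fspace \<Psi>"
    show "g (u + v) = g u + g v"
      using gf[OF fspace_add[OF mem[OF u] mem[OF v]]] f(2)[OF mem[OF u] mem[OF v]] fg[OF u] fg[OF v]
      by simp
  qed
qed

lemma scale_form_simps [simp]:
  "fspace (scale_form a \<Phi>) = fspace \<Phi>"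
  "scal (scale_form a \<Phi>) = scal \<Phi>"
  "val (scale_form a \<Phi>) v = a * val \<Phi> v"
  by (simp_all add: scale_form_def)

lemma scale_form_iso: "\<Phi> \<cong>\<^sub>F \<Psi> \<Longrightarrow> scale_form a \<Phi> \<cong>\<^sub>F scale_form a \<Psi>"
  unfolding form_iso_def by auto

lemma scale_form_scale_form: "scale_form a (scale_form b \<Phi>) = scale_form (a * b) \<Phi>"
  by (simp add: scale_form_def mult.assoc)

text \<open>
  An isomorphism of forms is linear only on the subspace \<open>fspace \<Phi>\<close>. It is replaced by a linear
  map \<open>g\<close> on the ambient space that agrees with it there.
\<close>

lemma form_dim_iso:
  assumes \<Phi>: "form_space \<Phi>" and \<Psi>: "form_space \<Psi>" and "\<Phi> \<cong>\<^sub>F \<Psi>"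
  shows "form_dim \<Phi> = form_dim \<Psi>"
proof -
  interpret \<Phi>: form_space \<Phi> by (rule \<Phi>)
  interpret \<Psi>: form_space \<Psi> by (rule \<Psi>)
  interpret vector_space_pair "scal \<Phi>" "scal \<Psi>" by unfold_locales
  obtain f where f: "bij_betw f (fspace \<Phi>) (fspace \<Psi>)"
    "\<And>u v. u \<in> fspace \<Phi> \<Longrightarrow> v \<in> fspace \<Phi> \<Longrightarrow> f (u + v) = f u + f v"
    "\<And>a v. v \<in> fspace \<Phi> \<Longrightarrow> f (scal \<Phi> a v) = scal \<Psi> a (f v)"
    using \<open>\<Phi> \<cong>\<^sub>F \<Psi>\<close> unfolding form_iso_def by blast
  obtain B where B: "B \<subseteq> fspace \<Phi>" "\<Phi>.independent B" "fspace \<Phi> \<subseteq> \<Phi>.span B" "card B = \<Phi>.dim (fspace \<Phi>)"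
    by (rule \<Phi>.basis_exists)
  have span: "\<Phi>.span B = fspace \<Phi>"
    using B \<Phi>.span_minimal[OF B(1) \<Phi>.subspace_fspace] by blast
  obtain g where g: "Vector_Spaces.linear (scal \<Phi>) (scal \<Psi>) g" "\<And>x. x \<in> B \<Longrightarrow> g x = f x"
    using linear_independent_extend[OF B(2), of f] by blast
  have f0: "f 0 = 0" using f(2)[OF \<Phi>.fspace_zero \<Phi>.fspace_zero] by simp
  have eq: "g x = f x" if "x \<in> fspace \<Phi>" for x
  proof -
    have "x \<in> \<Phi>.span B" using that span by simp
    then have "x \<in> fspace \<Phi> \<and> g x = f x"
    proof (induction rule: \<Phi>.span_induct_alt)
      case base
      then show ?case using linear_0[OF g(1)] f0 \<Phi>.fspace_zero by simp
    next
      case (step c x y)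
      then have "x \<in> fspace \<Phi>" using B(1) by blast
      then show ?case
        using step g f(2)[of "scal \<Phi> c x" y] f(3)[of x c]
        by (simp add: linear_add[OF g(1)] linear_scale[OF g(1)] \<Phi>.fspace_add \<Phi>.fspace_scale)
    qed
    then show ?thesis by simp
  qed
  have image: "g ` fspace \<Phi> = fspace \<Psi>" and inj: "inj_on g (fspace \<Phi>)"
    using f(1) eq by (auto simp: bij_betw_def cong: inj_on_cong image_cong)
  have "\<Psi>.independent (g ` B)"
    by (rule linear_independent_injective_image[OF g(1) B(2)]) (simp add: span inj)
  moreover have "\<Psi>.span (g ` B) = fspace \<Psi>"
    by (simp add: linear_span_image[OF g(1)] span image)
  moreover have "\<Psi>.span (fspace \<Psi>) = fspace \<Psi>"
    using \<Psi>.subspace_fspace by (simp add: \<Psi>.span_eq_iff)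
  ultimately have "\<Psi>.dim (fspace \<Psi>) = card (g ` B)"
    by (metis \<Psi>.dim_eq_card)
  also have "card (g ` B) = card B"
    by (rule card_image) (rule inj_on_subset[OF inj B(1)])
  finally show ?thesis by (simp add: form_dim_def B(4))
qed

section \<open>Similitudes of orthogonal sums\<close>

definition block_embed :: "'r \<Rightarrow> 'w::zero \<Rightarrow> 'w ^ 'r" where
  "block_embed i x = (\<chi> j. if j = i then x else 0)"

definition block_projection :: "'r \<Rightarrow> 'w::zero ^ 'r \<Rightarrow> 'w ^ 'r" where
  "block_projection i u = block_embed i (u $ i)"

lemma block_embed_nth: "block_embed i x $ j = (if j = i then x else 0)"
  by (simp add: block_embed_def)

lemma block_projection_eq_0_iff: "(\<forall>i. block_projection i u = 0) \<longleftrightarrow> u = 0"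
  by (auto simp: vec_eq_iff block_projection_def block_embed_nth)

lemma orth_sum_family_simps [simp]:
  "scal (orth_sum_family F) a u = (\<chi> i. scal (F i) a (u $ i))"
  "u \<in> fspace (orth_sum_family F) \<longleftrightarrow> (\<forall>i. u $ i \<in> fspace (F i))"
  "val (orth_sum_family F) u = (\<Sum>i\<in>UNIV. val (F i) (u $ i))"
  by (simp_all add: orth_sum_family_def)

lemma form_space_orth_sum_family:
  assumes "\<And>i. form_space (F i)"
  shows "form_space (orth_sum_family F)"
proof -
  interpret F: form_space "F i" for i by (rule assms)
  interpret vector_space "scal (orth_sum_family F)"
    by unfold_locales
      (simp_all add: vec_eq_iff F.scale_left_distrib F.scale_right_distrib)
  have "subspace (fspace (orth_sum_family F))"
    by (rule subspaceI) (simp_all add: F.fspace_zero F.fspace_add F.fspace_scale)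
  then show ?thesis by unfold_locales
qed

text \<open>
  The inverse map \<open>g\<close> is a parameter because conjugation by \<open>h\<close> occurs all the time, and because
  this makes the notion symmetric in \<open>h\<close> and \<open>g\<close>, up to inverting the factor \<open>a\<close>.
\<close>

definition similitude :: "'a \<Rightarrow> ('a::field, 'v::ab_group_add) form \<Rightarrow> ('v \<Rightarrow> 'v) \<Rightarrow> ('v \<Rightarrow> 'v) \<Rightarrow> bool" where
  "similitude a \<Phi> h g \<longleftrightarrow>
     (\<forall>x\<in>fspace \<Phi>. h x \<in> fspace \<Phi> \<and> g x \<in> fspace \<Phi> \<and> g (h x) = x \<and> h (g x) = x \<and>
        val \<Phi> (h x) = a * val \<Phi> x) \<and>
     (\<forall>x\<in>fspace \<Phi>. \<forall>y\<in>fspace \<Phi>. h (x + y) = h x + h y) \<and>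
     (\<forall>c. \<forall>x\<in>fspace \<Phi>. h (scal \<Phi> c x) = scal \<Phi> c (h x))"

lemma similitude_of_iso:
  assumes "scale_form a \<Phi> \<cong>\<^sub>F \<Phi>"
  obtains h g where "similitude a \<Phi> h g"
proof -
  obtain h where h: "bij_betw h (fspace \<Phi>) (fspace \<Phi>)"
    "\<And>u v. u \<in> fspace \<Phi> \<Longrightarrow> v \<in> fspace \<Phi> \<Longrightarrow> h (u + v) = h u + h v"
    "\<And>c v. v \<in> fspace \<Phi> \<Longrightarrow> h (scal \<Phi> c v) = scal \<Phi> c (h v)"
    "\<And>v. v \<in> fspace \<Phi> \<Longrightarrow> val \<Phi> (h v) = a * val \<Phi> v"
    using assms unfolding form_iso_def by auto
  have "similitude a \<Phi> h (inv_into (fspace \<Phi>) h)"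
    unfolding similitude_def
  proof (intro conjI ballI allI)
    fix x assume x: "x \<in> fspace \<Phi>"
    show "h x \<in> fspace \<Phi>" using h(1) x by (auto dest: bij_betwE)
    show "inv_into (fspace \<Phi>) h x \<in> fspace \<Phi>"
      using bij_betw_inv_into[OF h(1)] x by (auto dest: bij_betwE)
    show "inv_into (fspace \<Phi>) h (h x) = x" by (rule bij_betw_inv_into_left[OF h(1) x])
    show "h (inv_into (fspace \<Phi>) h x) = x" by (rule bij_betw_inv_into_right[OF h(1) x])
  qed (use h in auto)
  then show ?thesis by (rule that)
qed

context form_space
begin

lemma similitudeD:
  assumes "similitude a \<Phi> h g" "x \<in> fspace \<Phi>"
  shows "h x \<in> fspace \<Phi>" "g x \<in> fspace \<Phi>" "g (h x) = x" "h (g x) = x"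
    "val \<Phi> (h x) = a * val \<Phi> x" "y \<in> fspace \<Phi> \<Longrightarrow> h (x + y) = h x + h y"
    "h (scal \<Phi> c x) = scal \<Phi> c (h x)"
  using assms unfolding similitude_def by blast+

lemma similitude_inverse:
  assumes h: "similitude a \<Phi> h g" and "a \<noteq> 0"
  shows "similitude (inverse a) \<Phi> g h"
  unfolding similitude_def
proof (intro conjI ballI allI)
  note D = similitudeD[OF h]
  fix x assume x: "x \<in> fspace \<Phi>"
  show "val \<Phi> (g x) = inverse a * val \<Phi> x"
    using D(5)[OF D(2)[OF x]] D(4)[OF x] \<open>a \<noteq> 0\<close> by simp
  show "g (scal \<Phi> c x) = scal \<Phi> c (g x)" for c
    using D(7)[OF D(2)[OF x], of c] D(3)[OF fspace_scale[OF D(2)[OF x]], of c] D(4)[OF x] by simp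
  fix y assume y: "y \<in> fspace \<Phi>"
  show "g (x + y) = g x + g y"
    using D(6)[OF D(2)[OF x] D(2)[OF y]] D(3)[OF fspace_add[OF D(2)[OF x] D(2)[OF y]]]
      D(4)[OF x] D(4)[OF y] by simp
qed (use similitudeD[OF h] in auto)

lemma similitude_zero:
  assumes "similitude a \<Phi> h g"
  shows "h 0 = 0"
  using similitudeD(6)[OF assms fspace_zero fspace_zero] by simp

lemma similitude_diff:
  assumes h: "similitude a \<Phi> h g" and "x \<in> fspace \<Phi>" "y \<in> fspace \<Phi>"
  shows "h (x - y) = h x - h y"
  using similitudeD(6)[OF h fspace_diff[OF assms(2,3)] assms(3)] by (simp add: algebra_simps)

lemma conjugate_projection:
  assumes e: "orthogonal_projection \<Phi> e" and h: "similitude a \<Phi> h g" and "a \<noteq> 0"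
  shows "orthogonal_projection \<Phi> (\<lambda>x. g (e (h x)))"
proof -
  note H = similitudeD[OF h]
  note G = similitudeD[OF similitude_inverse[OF h \<open>a \<noteq> 0\<close>]]
  have mem: "e u \<in> fspace \<Phi>" if "u \<in> fspace \<Phi>" for u
    using e that unfolding orthogonal_projection_def by blast
  have idem: "e (e u) = e u" if "u \<in> fspace \<Phi>" for u
    using e that unfolding orthogonal_projection_def by blast
  have split: "val \<Phi> u = val \<Phi> (e u) + val \<Phi> (u - e u)" if "u \<in> fspace \<Phi>" for u
    using e that unfolding orthogonal_projection_def by blast
  have add: "e (u + v) = e u + e v" if "u \<in> fspace \<Phi>" "v \<in> fspace \<Phi>" for u v
    using e that unfolding orthogonal_projection_def by blast
  have scale: "e (scal \<Phi> c u) = scal \<Phi> c (e u)" if "u \<in> fspace \<Phi>" for c u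
    using e that unfolding orthogonal_projection_def by blast
  show ?thesis
    unfolding orthogonal_projection_def
  proof (intro conjI ballI allI)
    fix x assume x: "x \<in> fspace \<Phi>"
    note hx = H(1)[OF x]
    note ehx = mem[OF hx]
    show gx: "g (e (h x)) \<in> fspace \<Phi>" by (rule G(1)[OF ehx])
    show "g (e (h (g (e (h x))))) = g (e (h x))"
      by (simp add: H(4)[OF ehx] idem[OF hx])
    have "a * val \<Phi> x = val \<Phi> (e (h x)) + val \<Phi> (h x - e (h x))"
      using split[OF hx] H(5)[OF x] by simp
    also have "val \<Phi> (e (h x)) = a * val \<Phi> (g (e (h x)))"
      using H(5)[OF gx] H(4)[OF ehx] by simp
    also have "val \<Phi> (h x - e (h x)) = a * val \<Phi> (x - g (e (h x)))"
      using H(5)[OF fspace_diff[OF x gx]] H(4)[OF ehx] similitude_diff[OF h x gx] by simp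
    finally show "val \<Phi> x = val \<Phi> (g (e (h x))) + val \<Phi> (x - g (e (h x)))"
      using \<open>a \<noteq> 0\<close> by (simp add: distrib_left[symmetric] del: distrib_left)
    show "g (e (h (scal \<Phi> c x))) = scal \<Phi> c (g (e (h x)))" for c
      by (simp add: H(7)[OF x] scale[OF hx] G(7)[OF ehx])
    fix y assume y: "y \<in> fspace \<Phi>"
    show "g (e (h (x + y))) = g (e (h x)) + g (e (h y))"
      by (simp add: H(6)[OF x y] add[OF hx H(1)[OF y]] G(6)[OF ehx mem[OF H(1)[OF y]]])
  qed
qed

end

locale indecomposable_sum =
  fixes d :: nat and F :: "'r::finite \<Rightarrow> ('a::field, 'w::ab_group_add) form"
  assumes degree: "3 \<le> d"
    and invertible: "\<And>m. 0 < m \<Longrightarrow> m \<le> d \<Longrightarrow> of_nat m \<noteq> (0::'a)"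
    and form: "\<And>i. is_form d (F i)"
    and indecomposable: "\<And>i. indecomposable d (F i)"
begin

abbreviation V :: "('a, 'w ^ 'r) form" where "V \<equiv> orth_sum_family F"

sublocale F: form_space "F i" for i
  by (rule form_space_of_is_form[OF form])

sublocale V: form_space V
  by (rule form_space_orth_sum_family) (rule F.form_space_axioms)

lemma val_F_zero: "val (F i) 0 = 0"
  using is_form_zero[OF form] degree by simp

lemma block_embed_in_V: "x \<in> fspace (F i) \<Longrightarrow> block_embed i x \<in> fspace V"
  by (simp add: block_embed_nth F.fspace_zero)

lemma scal_block_embed: "scal V c (block_embed i x) = block_embed i (scal (F i) c x)"
  by (simp add: vec_eq_iff block_embed_nth)

lemma val_V_split: "val V u = val (F i) (u $ i) + (\<Sum>j\<in>-{i}. val (F j) (u $ j))"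
  by (simp add: Compl_eq_Diff_UNIV sum.remove[of UNIV i])

lemma val_add_block_embed:
  "val V (u + block_embed i x) = val (F i) (u $ i + x) + (\<Sum>j\<in>-{i}. val (F j) (u $ j))"
  unfolding val_V_split[of _ i] by (simp add: block_embed_nth)

lemma val_block_embed: "val V (block_embed i x) = val (F i) x"
  unfolding val_V_split[of _ i] by (simp add: block_embed_nth val_F_zero)

lemma orthogonal_projection_block_projection:
  "orthogonal_projection V (block_projection i)"
  unfolding orthogonal_projection_def
proof (intro conjI ballI allI)
  fix x assume x: "x \<in> fspace V"
  show "block_projection i x \<in> fspace V"
    using x by (simp add: block_projection_def block_embed_nth F.fspace_zero)
  show "block_projection i (block_projection i x) = block_projection i x"
    by (simp add: block_projection_def block_embed_nth)
  show "val V x = val V (block_projection i x) + val V (x - block_projection i x)"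
    unfolding block_projection_def val_block_embed val_V_split[of _ i]
    by (simp add: block_embed_nth val_F_zero)
  show "block_projection i (scal V c x) = scal V c (block_projection i x)" for c
    unfolding block_projection_def scal_block_embed by simp
  fix y show "block_projection i (x + y) = block_projection i x + block_projection i y"
    by (simp add: vec_eq_iff block_projection_def block_embed_nth)
qed

text \<open>
  The commutator \<open>r\<close> satisfies \<open>commutator_affine\<close> in \<open>V\<close>. For increments in the \<open>i\<close>-th summand the
  other summands contribute only a constant, so the same property holds for the \<open>i\<close>-th
  component of \<open>r\<close> in \<open>F i\<close>, where it forces this component to vanish.
\<close>

lemma projections_commute:
  assumes e: "orthogonal_projection V e" and f: "orthogonal_projection V f" and x: "x \<in> fspace V"
  shows "e (f x) = f (e x)"
proof -
  define r where "r = e (f x) - f (e x)"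
  have emem: "e u \<in> fspace V" and escale: "e (scal V c u) = scal V c (e u)"
    if "u \<in> fspace V" for u c
    using e that unfolding orthogonal_projection_def by blast+
  have fmem: "f u \<in> fspace V" and fscale: "f (scal V c u) = scal V c (f u)"
    if "u \<in> fspace V" for u c
    using f that unfolding orthogonal_projection_def by blast+
  have r: "r \<in> fspace V"
    unfolding r_def by (rule V.fspace_diff) (intro emem fmem x)+
  have scale_r: "e (f (scal V s x)) - f (e (scal V s x)) = scal V s r" for s
    unfolding r_def fscale[OF x] escale[OF x] escale[OF fmem[OF x]] fscale[OF emem[OF x]]
    by (rule V.scale_right_diff_distrib[symmetric])
  have "r $ i = 0" for i
  proof (rule indecomposable_radical_trivial[OF form _ indecomposable])
    show "0 < d" using degree by simp
    show ri: "r $ i \<in> fspace (F i)" using r by simp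
    fix s w assume w: "w \<in> fspace (F i)"
    show "val (F i) (scal (F i) s (r $ i) + w) = val (F i) w"
    proof (rule val_translation_invariant[OF form degree _ ri w])
      fix s y z assume y: "y \<in> fspace (F i)" and z: "z \<in> fspace (F i)"
      \<comment> \<open>The value of the other components; it does not depend on the increment.\<close>
      define R where "R = (\<Sum>j\<in>-{i}. val (F j) (scal V s r $ j))"
      have sum: "block_embed i y + block_embed i z = block_embed i (y + z)"
        by (simp add: vec_eq_iff block_embed_nth)
      have val: "val V (scal V s r + block_embed i u) = val (F i) (scal (F i) s (r $ i) + u) + R" for u
        unfolding val_add_block_embed R_def by simp
      have val0: "val V (scal V s r) = val (F i) (scal (F i) s (r $ i)) + R"
        unfolding val_V_split[of _ i] R_def by simp
      have "val V 0 = 0" using val_block_embed[of i 0] val_F_zero[of i]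
        by (simp add: val_F_zero)
      then show "second_difference (\<lambda>v. val (F i) (scal (F i) s (r $ i) + v) - val (F i) v) y z 0 = 0"
        using V.commutator_affine[OF e f V.fspace_scale[OF x, of s] block_embed_in_V[OF y] block_embed_in_V[OF z]]
        unfolding second_difference_def add_0_right scale_r sum val val0 val_block_embed by (simp add: val_F_zero algebra_simps)
    qed (use invertible in auto)
  qed
  then have "r = 0" by (simp add: vec_eq_iff)
  then show ?thesis by (simp add: r_def)
qed

text \<open>
  The projections \<open>P j = g \<circ> block_projection j \<circ> h\<close> commute with the projection onto the \<open>i\<close>-th
  summand and therefore act on it, as orthogonal projections \<open>p j\<close> of the indecomposable form \<open>F i\<close>.
  So each \<open>p j\<close> is \<open>0\<close> or the identity. Not all are \<open>0\<close>, since the \<open>j\<close>-th components of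
  \<open>h (block_embed i x)\<close> cannot vanish simultaneously for every \<open>j\<close>. If \<open>p j\<close> is the identity, then
  \<open>h\<close> maps the \<open>i\<close>-th summand into the \<open>j\<close>-th one.
\<close>

lemma similitude_maps_block:
  assumes h: "similitude a V h g" and "a \<noteq> 0"
  obtains j where "\<And>x. x \<in> fspace (F i) \<Longrightarrow> block_projection j (h (block_embed i x)) = h (block_embed i x)"
proof -
  note H = V.similitudeD[OF h]
  define P where "P j u = g (block_projection j (h u))" for j u
  have P: "orthogonal_projection V (P j)" for j
    unfolding P_def
    by (rule V.conjugate_projection[OF orthogonal_projection_block_projection h \<open>a \<noteq> 0\<close>])
  have Pmem: "P j u \<in> fspace V" and Pidem: "P j (P j u) = P j u"
    and Psplit: "val V u = val V (P j u) + val V (u - P j u)"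
    and Pscale: "P j (scal V c u) = scal V c (P j u)" if "u \<in> fspace V" for j u c
    using P[of j] that unfolding orthogonal_projection_def by blast+
  have Padd: "P j (u + v) = P j u + P j v" if "u \<in> fspace V" "v \<in> fspace V" for j u v
    using P[of j] that unfolding orthogonal_projection_def by blast
  define p where "p j x = P j (block_embed i x) $ i" for j x
  have P_embed: "P j (block_embed i x) = block_embed i (p j x)" if "x \<in> fspace (F i)" for j x
    using projections_commute[OF P orthogonal_projection_block_projection block_embed_in_V[OF that], of j i]
    by (simp add: block_projection_def block_embed_nth p_def)
  have p: "orthogonal_projection (F i) (p j)" for j
    unfolding orthogonal_projection_def
  proof (intro conjI ballI allI)
    fix x assume x: "x \<in> fspace (F i)"
    note ex = block_embed_in_V[OF x]
    show px: "p j x \<in> fspace (F i)" using Pmem[OF ex, of j] by (simp add: p_def)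
    show "p j (p j x) = p j x"
      using Pidem[OF ex, of j] unfolding P_embed[OF x] P_embed[OF px]
      by (simp add: vec_eq_iff block_embed_nth split: if_splits)
    have "block_embed i x - block_embed i (p j x) = block_embed i (x - p j x)"
      by (simp add: vec_eq_iff block_embed_nth)
    then show "val (F i) x = val (F i) (p j x) + val (F i) (x - p j x)"
      using Psplit[OF ex, of j] unfolding P_embed[OF x] by (simp only: val_block_embed)
    show "p j (scal (F i) c x) = scal (F i) c (p j x)" for c
      using Pscale[OF ex, of j c] by (simp add: p_def scal_block_embed del: orth_sum_family_simps(1))
        (simp)
    fix y assume y: "y \<in> fspace (F i)"
    have "block_embed i (x + y) = block_embed i x + block_embed i y"
      by (simp add: vec_eq_iff block_embed_nth)
    then show "p j (x + y) = p j x + p j y"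
      using Padd[OF ex block_embed_in_V[OF y], of j] by (simp add: p_def)
  qed
  have "\<exists>j. \<exists>x\<in>fspace (F i). p j x \<noteq> 0"
  proof (rule ccontr)
    assume "\<not> ?thesis"
    then have zero: "p j x = 0" if "x \<in> fspace (F i)" for j x using that by blast
    have "x = 0" if x: "x \<in> fspace (F i)" for x
    proof -
      let ?u = "h (block_embed i x)"
      have u: "?u \<in> fspace V" by (rule H(1)[OF block_embed_in_V[OF x]])
      have "block_projection j ?u = 0" for j
      proof -
        have "block_projection j ?u \<in> fspace V"
          using orthogonal_projection_block_projection u unfolding orthogonal_projection_def by blast
        then have "block_projection j ?u = h (P j (block_embed i x))"
          unfolding P_def by (rule H(4)[symmetric])
        also have "P j (block_embed i x) = 0"
          unfolding P_embed[OF x] zero[OF x] by (simp add: vec_eq_iff block_embed_nth)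
        finally show ?thesis by (simp add: V.similitude_zero[OF h])
      qed
      then have "?u = 0" using block_projection_eq_0_iff by blast
      then have "h (block_embed i x) = h 0" by (simp add: V.similitude_zero[OF h])
      then have "block_embed i x = 0"
        using H(3)[OF block_embed_in_V[OF x]] H(3)[OF V.fspace_zero] by simp
      then show ?thesis by (simp add: vec_eq_iff block_embed_nth split: if_splits)
    qed
    then show False
      using indecomposable[of i] val_F_zero[of i]
      unfolding indecomposable_def nonzero_form_def by blast
  qed
  then obtain j where "\<exists>x\<in>fspace (F i). p j x \<noteq> 0" by blast
  then have id: "p j x = x" if "x \<in> fspace (F i)" for x
    using indecomposable_projection[OF form indecomposable p, of j] that by blast
  show ?thesis
  proof (rule that)
    fix x assume x: "x \<in> fspace (F i)"
    have "block_projection j (h (block_embed i x)) \<in> fspace V"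
      using orthogonal_projection_block_projection H(1)[OF block_embed_in_V[OF x]]
      unfolding orthogonal_projection_def by blast
    from H(4)[OF this] show "block_projection j (h (block_embed i x)) = h (block_embed i x)"
      using P_embed[OF x, of j] id[OF x] by (simp add: P_def)
  qed
qed

text \<open>
  Uniqueness of the indecomposable summands, for similitudes in place of isometries. If \<open>h\<close> maps
  the \<open>i\<close>-th summand into the one of index \<open>\<sigma> i\<close>, and \<open>g\<close> maps the latter into the summand of index
  \<open>\<tau> (\<sigma> i)\<close>, then this summand contains the nonzero \<open>i\<close>-th one, so \<open>\<tau> (\<sigma> i) = i\<close>. Consequently
  \<open>\<sigma>\<close> is injective, and the restrictions of \<open>h\<close> and \<open>g\<close> are inverse to each other.
\<close>

theorem similitude_permutes_summands:
  assumes "scale_form a V \<cong>\<^sub>F V" and "a \<noteq> 0"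
  obtains \<sigma> where "inj \<sigma>" "\<And>i. scale_form a (F i) \<cong>\<^sub>F F (\<sigma> i)"
proof -
  obtain h g where h: "similitude a V h g"
    by (rule similitude_of_iso[OF assms(1)])
  have g: "similitude (inverse a) V g h"
    by (rule V.similitude_inverse[OF h \<open>a \<noteq> 0\<close>])
  note H = V.similitudeD[OF h] and G = V.similitudeD[OF g]
  have "\<exists>j. \<forall>x\<in>fspace (F i). block_projection j (h (block_embed i x)) = h (block_embed i x)" for i
    using similitude_maps_block[OF h \<open>a \<noteq> 0\<close>, of i] by metis
  then obtain \<sigma> where \<sigma>: "\<And>i x. x \<in> fspace (F i) \<Longrightarrow>
      block_embed (\<sigma> i) (h (block_embed i x) $ \<sigma> i) = h (block_embed i x)"
    unfolding block_projection_def by metis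
  have "\<exists>j. \<forall>x\<in>fspace (F i). block_projection j (g (block_embed i x)) = g (block_embed i x)" for i
    using similitude_maps_block[OF g, of i] \<open>a \<noteq> 0\<close> by (metis inverse_nonzero_iff_nonzero)
  then obtain \<tau> where \<tau>: "\<And>i x. x \<in> fspace (F i) \<Longrightarrow>
      block_embed (\<tau> i) (g (block_embed i x) $ \<tau> i) = g (block_embed i x)"
    unfolding block_projection_def by metis
  define T where "T i x = h (block_embed i x) $ \<sigma> i" for i x
  have Tmem: "T i x \<in> fspace (F (\<sigma> i))" if "x \<in> fspace (F i)" for i x
    using H(1)[OF block_embed_in_V[OF that]] by (simp add: T_def)
  have gT: "g (block_embed (\<sigma> i) (T i x)) = block_embed i x" if "x \<in> fspace (F i)" for i x
    unfolding T_def \<sigma>[OF that] by (rule H(3)[OF block_embed_in_V[OF that]])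
  have \<tau>\<sigma>: "\<tau> (\<sigma> i) = i" for i
  proof (rule ccontr)
    assume ne: "\<tau> (\<sigma> i) \<noteq> i"
    obtain x where x: "x \<in> fspace (F i)" "x \<noteq> 0"
      using indecomposable[of i] val_F_zero[of i]
      unfolding indecomposable_def nonzero_form_def by metis
    have "block_embed (\<tau> (\<sigma> i)) (block_embed i x $ \<tau> (\<sigma> i)) = block_embed i x"
      using \<tau>[OF Tmem[OF x(1)]] unfolding gT[OF x(1)] .
    then have "block_embed i x $ i = 0" using ne
      by (simp add: vec_eq_iff block_embed_nth split: if_splits)
    then show False using x(2) by (simp add: block_embed_nth)
  qed
  have "inj \<sigma>" by (rule inj_on_inverseI[where g = \<tau>]) (rule \<tau>\<sigma>)
  moreover have "scale_form a (F i) \<cong>\<^sub>F F (\<sigma> i)" for i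
    unfolding form_iso_def
  proof (intro exI[of _ "T i"] conjI ballI allI)
    show "bij_betw (T i) (fspace (scale_form a (F i))) (fspace (F (\<sigma> i)))"
    proof (rule bij_betw_byWitness[where f' = "\<lambda>y. g (block_embed (\<sigma> i) y) $ i"])
      show "\<forall>x\<in>fspace (scale_form a (F i)). g (block_embed (\<sigma> i) (T i x)) $ i = x"
        by (simp add: gT block_embed_nth)
      show "T i ` fspace (scale_form a (F i)) \<subseteq> fspace (F (\<sigma> i))"
        using Tmem by auto
      show "(\<lambda>y. g (block_embed (\<sigma> i) y) $ i) ` fspace (F (\<sigma> i)) \<subseteq> fspace (scale_form a (F i))"
        using G(1)[OF block_embed_in_V] by auto
      show "\<forall>y\<in>fspace (F (\<sigma> i)). T i (g (block_embed (\<sigma> i) y) $ i) = y"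
      proof
        fix y assume y: "y \<in> fspace (F (\<sigma> i))"
        have "block_embed i (g (block_embed (\<sigma> i) y) $ i) = g (block_embed (\<sigma> i) y)"
          using \<tau>[OF y] unfolding \<tau>\<sigma> .
        then show "T i (g (block_embed (\<sigma> i) y) $ i) = y"
          unfolding T_def using H(4)[OF block_embed_in_V[OF y]] by (simp add: block_embed_nth)
      qed
    qed
  next
    fix x assume "x \<in> fspace (scale_form a (F i))"
    then have x: "x \<in> fspace (F i)" by simp
    show "val (F (\<sigma> i)) (T i x) = val (scale_form a (F i)) x"
      using H(5)[OF block_embed_in_V[OF x]] \<sigma>[OF x] val_block_embed[of "\<sigma> i" "T i x"]
        val_block_embed[of i x] unfolding T_def scale_form_simps by metis
    show "T i (scal (scale_form a (F i)) c x) = scal (F (\<sigma> i)) c (T i x)" for c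
      using H(7)[OF block_embed_in_V[OF x], of c] unfolding scal_block_embed by (simp add: T_def)
    fix y assume "y \<in> fspace (scale_form a (F i))"
    then have y: "y \<in> fspace (F i)" by simp
    have "block_embed i (x + y) = block_embed i x + block_embed i y"
      by (simp add: vec_eq_iff block_embed_nth)
    then show "T i (x + y) = T i x + T i y"
      using H(6)[OF block_embed_in_V[OF x] block_embed_in_V[OF y]] by (simp add: T_def)
  qed
  ultimately show ?thesis by (rule that)
qed

lemma similarity_factor_nonzero:
  assumes "scale_form a V \<cong>\<^sub>F V"
  shows "a \<noteq> 0"
proof
  assume "a = 0"
  obtain h g where h: "similitude a V h g"
    by (rule similitude_of_iso[OF assms])
  fix i :: 'r
  obtain x where x: "x \<in> fspace (F i)" "val (F i) x \<noteq> 0"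
    using indecomposable[of i] unfolding indecomposable_def nonzero_form_def by blast
  note H = V.similitudeD[OF h]
  note ex = block_embed_in_V[OF x(1)]
  have "val V (block_embed i x) = a * val V (g (block_embed i x))"
    using H(5)[OF H(2)[OF ex]] H(4)[OF ex] by simp
  then show False using \<open>a = 0\<close> x(2) unfolding val_block_embed by simp
qed

end

text \<open>
  The constants embed into the field of rational functions, so both fields have the same
  characteristic.
\<close>

lemma of_nat_ratfun_nonzero:
  assumes "CHAR('k::field) = 0 \<or> CHAR('k) > d" and "0 < m" and "m \<le> d"
  shows "of_nat m \<noteq> (0 :: ('n::{finite, linorder}, 'k) ratfun)"
proof -
  have "(of_nat m :: 'k) \<noteq> 0"
    using assms by (auto simp: of_nat_eq_0_iff_char_dvd dest: dvd_imp_le)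
  moreover have "Poly_Mapping.lookup (of_nat m :: ('n, 'k) mpoly) 0 = of_nat m"
    by (simp add: lookup_of_nat)
  ultimately have "(of_nat m :: ('n, 'k) mpoly) \<noteq> 0"
    by (metis lookup_zero)
  then show ?thesis
    by (simp add: of_nat_fract Zero_fract_def eq_fract)
qed

lemma form_space_scalar_extension: "form_space (scalar_extension d b \<phi>)"
proof -
  interpret vector_space "scal (scalar_extension d b \<phi>)"
    unfolding scalar_extension_def by (simp add: vec.vector_space_axioms)
  show ?thesis
    by unfold_locales (simp add: scalar_extension_def)
qed

lemma strongly_multiplicative_permutation:
  fixes F :: "'r::finite \<Rightarrow> (('n::{finite, linorder}, 'k::field) ratfun, 'w::ab_group_add) form"
  assumes "3 \<le> d" and "CHAR('k) = 0 \<or> CHAR('k) > d"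
    and "\<And>i. is_form d (F i)" and "\<And>i. indecomposable d (F i)"
    and iso: "scalar_extension d b \<phi> \<cong>\<^sub>F orth_sum_family F"
    and "strongly_multiplicative d b \<phi>"
  obtains \<sigma> where "inj \<sigma>" "\<And>i. form_dim (F (\<sigma> i)) = form_dim (F i)"
    "\<And>i. scale_form (generic_value d b \<phi>) (F i) \<cong>\<^sub>F F (\<sigma> i)" "generic_value d b \<phi> \<noteq> 0"
proof -
  let ?a = "generic_value d b \<phi>"
  interpret indecomposable_sum d F
    by unfold_locales (use assms of_nat_ratfun_nonzero in auto)
  note [trans] = form_iso_trans
  have "scale_form ?a V \<cong>\<^sub>F scale_form ?a (scalar_extension d b \<phi>)"
    by (rule scale_form_iso, rule form_iso_sym[OF form_space_scalar_extension iso])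
  also have "scale_form ?a (scalar_extension d b \<phi>) \<cong>\<^sub>F scalar_extension d b \<phi>"
    using \<open>strongly_multiplicative d b \<phi>\<close> by (simp add: strongly_multiplicative_def)
  also note iso
  finally have sim: "scale_form ?a V \<cong>\<^sub>F V" .
  then have "?a \<noteq> 0" by (rule similarity_factor_nonzero)
  obtain \<sigma> where \<sigma>: "inj \<sigma>" "\<And>i. scale_form ?a (F i) \<cong>\<^sub>F F (\<sigma> i)"
    using similitude_permutes_summands[OF sim \<open>?a \<noteq> 0\<close>] by blast
  have "form_dim (F (\<sigma> i)) = form_dim (F i)" for i
  proof -
    have "form_space (scale_form ?a (F i))"
      using F.form_space_axioms[of i] by (simp add: form_space_def form_space_axioms_def)
    from form_dim_iso[OF this F.form_space_axioms \<sigma>(2)]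
    show ?thesis by (simp add: form_dim_def)
  qed
  then show ?thesis using that \<sigma> \<open>?a \<noteq> 0\<close> by blast
qed

section \<open>Failure of strong multiplicativity\<close>

theorem theorem4:
  fixes d :: nat
    and \<phi> :: "('k::field, 'v::ab_group_add) form"
    and b :: "'n::{finite, linorder} \<Rightarrow> 'v"
    and F :: "'r::finite \<Rightarrow> (('n, 'k) ratfun, 'w::ab_group_add) form"
  assumes "d \<ge> 3"
    and "CHAR('k) = 0 \<or> CHAR('k) > d"
    and "is_form d \<phi>" and "nondegenerate d \<phi>" and "decomposable d \<phi>"
    and "is_basis \<phi> UNIV b"
    and "CARD('r) > 1"
    and "\<And>i. is_form d (F i)" and "\<And>i. indecomposable d (F i)"
    and "scalar_extension d b \<phi> \<cong>\<^sub>F orth_sum_family F"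
  shows
    "((\<forall>i j. i \<noteq> j \<longrightarrow> form_dim (F i) \<noteq> form_dim (F j)) \<and>
      (\<exists>i\<^sub>0. generic_value d b \<phi> \<notin> similarity_factors (F i\<^sub>0))
        \<longrightarrow> \<not> strongly_multiplicative d b \<phi>)
   \<and> ((\<exists>i\<^sub>0 i\<^sub>1. i\<^sub>0 \<noteq> i\<^sub>1 \<and> form_dim (F i\<^sub>0) = form_dim (F i\<^sub>1) \<and>
        (\<forall>i. i \<notin> {i\<^sub>0, i\<^sub>1} \<longrightarrow> form_dim (F i) \<noteq> form_dim (F i\<^sub>0)) \<and>
        (\<exists>h \<in> {i\<^sub>0, i\<^sub>1}. \<exists>s \<in> {i\<^sub>0, i\<^sub>1}.
           generic_value d b \<phi> \<notin> similarity_factors (F h) \<and>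
           (generic_value d b \<phi>)\<^sup>2 \<notin> similarity_factors (F s)))
        \<longrightarrow> \<not> strongly_multiplicative d b \<phi>)
   \<and> ((\<exists>i\<^sub>0 i\<^sub>1. i\<^sub>0 \<noteq> i\<^sub>1 \<and> form_dim (F i\<^sub>0) \<noteq> form_dim (F i\<^sub>1) \<and>
        (\<forall>i j. i \<notin> {i\<^sub>0, i\<^sub>1} \<and> j \<notin> {i\<^sub>0, i\<^sub>1} \<longrightarrow> form_dim (F i) = form_dim (F j)) \<and>
        (\<forall>i. i \<notin> {i\<^sub>0, i\<^sub>1} \<longrightarrow>
           form_dim (F i) \<noteq> form_dim (F i\<^sub>0) \<and> form_dim (F i) \<noteq> form_dim (F i\<^sub>1)) \<and>
        (\<exists>h \<in> {i\<^sub>0, i\<^sub>1}. generic_value d b \<phi> \<notin> similarity_factors (F h)))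
        \<longrightarrow> \<not> strongly_multiplicative d b \<phi>)"
proof -
  let ?a = "generic_value d b \<phi>"
  have fixed: "?a \<in> similarity_factors (F i)"
    if "?a \<noteq> 0" "scale_form ?a (F i) \<cong>\<^sub>F F j" "j = i" for i j
    using that by (simp add: similarity_factors_def)
  have swapped: "?a\<^sup>2 \<in> similarity_factors (F i)"
    if "?a \<noteq> 0" "scale_form ?a (F i) \<cong>\<^sub>F F j" "scale_form ?a (F j) \<cong>\<^sub>F F i" for i j
    using that form_iso_trans[OF scale_form_iso[OF that(2), of ?a] that(3)]
    by (simp add: similarity_factors_def scale_form_scale_form power2_eq_square)
  show ?thesis
  proof (intro conjI impI notI)
    assume hyp: "(\<forall>i j. i \<noteq> j \<longrightarrow> form_dim (F i) \<noteq> form_dim (F j)) \<and>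
        (\<exists>i\<^sub>0. ?a \<notin> similarity_factors (F i\<^sub>0))"
      and mult: "strongly_multiplicative d b \<phi>"
    obtain \<sigma> where "inj \<sigma>" and \<sigma>: "\<And>i. form_dim (F (\<sigma> i)) = form_dim (F i)"
      "\<And>i. scale_form ?a (F i) \<cong>\<^sub>F F (\<sigma> i)" "?a \<noteq> 0"
      using strongly_multiplicative_permutation[OF assms(1,2,8,9,10) mult] by blast
    have "\<sigma> i = i" for i using hyp \<sigma>(1)[of i] by blast
    then show False using hyp fixed[OF \<sigma>(3) \<sigma>(2)] by blast
  next
    assume hyp: "\<exists>i\<^sub>0 i\<^sub>1. i\<^sub>0 \<noteq> i\<^sub>1 \<and> form_dim (F i\<^sub>0) = form_dim (F i\<^sub>1) \<and>
        (\<forall>i. i \<notin> {i\<^sub>0, i\<^sub>1} \<longrightarrow> form_dim (F i) \<noteq> form_dim (F i\<^sub>0)) \<and>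
        (\<exists>h \<in> {i\<^sub>0, i\<^sub>1}. \<exists>s \<in> {i\<^sub>0, i\<^sub>1}.
           ?a \<notin> similarity_factors (F h) \<and> ?a\<^sup>2 \<notin> similarity_factors (F s))"
      and mult: "strongly_multiplicative d b \<phi>"
    obtain \<sigma> where \<sigma>: "inj \<sigma>" "\<And>i. form_dim (F (\<sigma> i)) = form_dim (F i)"
      "\<And>i. scale_form ?a (F i) \<cong>\<^sub>F F (\<sigma> i)" "?a \<noteq> 0"
      using strongly_multiplicative_permutation[OF assms(1,2,8,9,10) mult] by blast
    obtain i\<^sub>0 i\<^sub>1 h s where ne: "i\<^sub>0 \<noteq> i\<^sub>1" and dim: "form_dim (F i\<^sub>0) = form_dim (F i\<^sub>1)"
      "\<And>i. i \<notin> {i\<^sub>0, i\<^sub>1} \<Longrightarrow> form_dim (F i) \<noteq> form_dim (F i\<^sub>0)"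
      and h: "h \<in> {i\<^sub>0, i\<^sub>1}" "?a \<notin> similarity_factors (F h)"
      and s: "s \<in> {i\<^sub>0, i\<^sub>1}" "?a\<^sup>2 \<notin> similarity_factors (F s)"
      using hyp by blast
    have "\<sigma> i\<^sub>0 \<in> {i\<^sub>0, i\<^sub>1}" "\<sigma> i\<^sub>1 \<in> {i\<^sub>0, i\<^sub>1}"
      using dim \<sigma>(2)[of i\<^sub>0] \<sigma>(2)[of i\<^sub>1] by metis+
    moreover have "\<sigma> i\<^sub>0 \<noteq> \<sigma> i\<^sub>1" using \<sigma>(1) ne by (simp add: inj_eq)
    ultimately consider "\<sigma> i\<^sub>0 = i\<^sub>0" "\<sigma> i\<^sub>1 = i\<^sub>1" | "\<sigma> i\<^sub>0 = i\<^sub>1" "\<sigma> i\<^sub>1 = i\<^sub>0"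
      unfolding insert_iff empty_iff by metis
    then show False
    proof cases
      case 1
      then have "\<sigma> h = h" using h(1) by blast
      then show False using h(2) fixed[OF \<sigma>(4) \<sigma>(3)] by metis
    next
      case 2
      then have "\<sigma> (\<sigma> s) = s" using s(1) unfolding insert_iff empty_iff by metis
      then have "scale_form ?a (F (\<sigma> s)) \<cong>\<^sub>F F s" using \<sigma>(3)[of "\<sigma> s"] by simp
      from swapped[OF \<sigma>(4) \<sigma>(3) this] show False using s(2) by blast
    qed
  next
    assume hyp: "\<exists>i\<^sub>0 i\<^sub>1. i\<^sub>0 \<noteq> i\<^sub>1 \<and> form_dim (F i\<^sub>0) \<noteq> form_dim (F i\<^sub>1) \<and>
        (\<forall>i j. i \<notin> {i\<^sub>0, i\<^sub>1} \<and> j \<notin> {i\<^sub>0, i\<^sub>1} \<longrightarrow> form_dim (F i) = form_dim (F j)) \<and>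
        (\<forall>i. i \<notin> {i\<^sub>0, i\<^sub>1} \<longrightarrow>
           form_dim (F i) \<noteq> form_dim (F i\<^sub>0) \<and> form_dim (F i) \<noteq> form_dim (F i\<^sub>1)) \<and>
        (\<exists>h \<in> {i\<^sub>0, i\<^sub>1}. ?a \<notin> similarity_factors (F h))"
      and mult: "strongly_multiplicative d b \<phi>"
    obtain \<sigma> where "inj \<sigma>" and \<sigma>: "\<And>i. form_dim (F (\<sigma> i)) = form_dim (F i)"
      "\<And>i. scale_form ?a (F i) \<cong>\<^sub>F F (\<sigma> i)" "?a \<noteq> 0"
      using strongly_multiplicative_permutation[OF assms(1,2,8,9,10) mult] by blast
    obtain i\<^sub>0 i\<^sub>1 h where dim: "form_dim (F i\<^sub>0) \<noteq> form_dim (F i\<^sub>1)"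
      "\<And>i. i \<notin> {i\<^sub>0, i\<^sub>1} \<Longrightarrow>
        form_dim (F i) \<noteq> form_dim (F i\<^sub>0) \<and> form_dim (F i) \<noteq> form_dim (F i\<^sub>1)"
      and h: "h \<in> {i\<^sub>0, i\<^sub>1}" "?a \<notin> similarity_factors (F h)"
      using hyp by blast
    have "\<sigma> h \<in> {i\<^sub>0, i\<^sub>1}"
      using dim(2)[of "\<sigma> h"] \<sigma>(1)[of h] h(1) unfolding insert_iff empty_iff by metis
    then have "\<sigma> h = h"
      using dim(1) \<sigma>(1)[of h] h(1) unfolding insert_iff empty_iff by metis
    then show False using h(2) fixed[OF \<sigma>(3) \<sigma>(2)] by blast
  qed
qed

end
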